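(* Let $d\ge1$, $k\ge2$ be integers, $K$ a subfield of $\mathbb{C}$, and $P\in K[X_1,\ldots,X_d]\setminus\{0\}$ with at most $k$ nonzero terms. There is a constant $C(d,k)>0$ depending only on $d,k$ such that for every $a=(a_1,\ldots,a_d)\in\mathbb{Z}^d\setminus\{0\}$ with $\rho(a)>\deg P$ we have $$\bigl|m(P(X^{a_1},\ldots,X^{a_d}))-m(P)\bigr|\le C(d,k)\frac{\deg(P)^{16d^2}}{\rho(a)^{1/(16(k-1))}}.$$ (For $d=1$, where $\rho(a)=\infty$, this is to be read as $m(P(X^{a}))=m(P)$.)
   Context: $|\cdot|$ denotes the maximum norm on $\mathbb{Z}^d$. $\rho(a)=\inf\{|v|:v\in\mathbb{Z}^d\setminus\{0\},\langle a,v\rangle=0\}$, with $\inf\emptyset=\infty$. $\deg P$ is the total degree. The Mahler measure of a nonzero Laurent polynomial $R$ in $n$ variables is $m(R)=\int_{[0,1)^n}\log|R(e^{2\pi\sqrt{-1}x_1},\ldots,e^{2\pi\sqrt{-1}x_n})|dx$. *)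

theory Defs
  imports "HOL-Analysis.Analysis" "HOL-Library.Poly_Mapping" "HOL-Library.Extended_Nat"
begin

text \<open>
  An integer vector of dimension \<open>d\<close> is a function \<open>v :: nat \<Rightarrow> int\<close> of which only the
  components \<open>v i\<close> with \<open>i < d\<close> matter; everything below ignores the remaining ones.
\<close>

definition nonzero_vec :: "nat \<Rightarrow> (nat \<Rightarrow> int) \<Rightarrow> bool" where
  "nonzero_vec d v \<longleftrightarrow> (\<exists>i<d. v i \<noteq> 0)"

text \<open>Meant for \<open>d \<ge> 1\<close> only, since it takes the maximum over \<open>{..<d}\<close>.\<close>

definition max_norm :: "nat \<Rightarrow> (nat \<Rightarrow> int) \<Rightarrow> nat" where
  "max_norm d v = Max ((\<lambda>i. nat \<bar>v i\<bar>) ` {..<d})"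

text \<open>In \<^typ>\<open>enat\<close> the infimum of the empty set is \<open>\<infinity>\<close>.\<close>

definition rho :: "nat \<Rightarrow> (nat \<Rightarrow> int) \<Rightarrow> enat" where
  "rho d a = (INF v\<in>{v. nonzero_vec d v \<and> (\<Sum>i<d. a i * v i) = 0}. enat (max_norm d v))"

text \<open>
  A polynomial or Laurent polynomial maps exponent vectors to coefficients; the ring structure
  is the convolution ring of \<^theory>\<open>HOL-Library.Poly_Mapping\<close>. The variables are
  \<open>X\<^sub>i\<close> for \<open>i :: nat\<close>.
\<close>

type_synonym mpoly = "(nat \<Rightarrow>\<^sub>0 nat) \<Rightarrow>\<^sub>0 complex"
type_synonym laurent = "(nat \<Rightarrow>\<^sub>0 int) \<Rightarrow>\<^sub>0 complex"

definition is_subfield :: "complex set \<Rightarrow> bool" where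
  "is_subfield K \<longleftrightarrow> 0 \<in> K \<and> 1 \<in> K \<and>
     (\<forall>x\<in>K. \<forall>y\<in>K. x + y \<in> K \<and> x * y \<in> K) \<and> (\<forall>x\<in>K. - x \<in> K \<and> inverse x \<in> K)"

text \<open>The polynomials over \<open>K\<close> in the \<open>d\<close> variables \<open>X\<^sub>i\<close>, \<open>i < d\<close>.\<close>

definition mpolys :: "complex set \<Rightarrow> nat \<Rightarrow> mpoly set" where
  "mpolys K d = {P. \<forall>m\<in>Poly_Mapping.keys P.
     Poly_Mapping.lookup P m \<in> K \<and> Poly_Mapping.keys m \<subseteq> {..<d}}"

text \<open>The inserted \<open>0\<close> only matters for the zero polynomial.\<close>

definition total_degree :: "mpoly \<Rightarrow> nat" where
  "total_degree P =
     Max (insert 0 ((\<lambda>m. \<Sum>i\<in>Poly_Mapping.keys m. Poly_Mapping.lookup m i)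
       ` Poly_Mapping.keys P))"

text \<open>The variable \<open>X\<^sub>i\<close> raised to the integer power \<open>e\<close>.\<close>

definition X_pow :: "nat \<Rightarrow> int \<Rightarrow> laurent" where
  "X_pow i e = Poly_Mapping.single (Poly_Mapping.single i e) 1"

definition mpoly_subst :: "(nat \<Rightarrow> laurent) \<Rightarrow> mpoly \<Rightarrow> laurent" where
  "mpoly_subst f P =
     (\<Sum>m\<in>Poly_Mapping.keys P. Poly_Mapping.single 0 (Poly_Mapping.lookup P m) *
        (\<Prod>i\<in>Poly_Mapping.keys m. f i ^ Poly_Mapping.lookup m i))"

text \<open>\<open>P\<close> itself, regarded as a Laurent polynomial.\<close>

definition laurent_of :: "mpoly \<Rightarrow> laurent" where
  "laurent_of P = mpoly_subst (\<lambda>i. X_pow i 1) P"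

text \<open>All variables are replaced by powers of the single variable \<open>X = X\<^sub>0\<close>, namely
  \<open>X\<^sub>i\<close> by \<open>X\<close> to the power \<open>a i\<close>; the result has to be measured by \<open>mahler 1\<close>.\<close>

definition subst_powers :: "(nat \<Rightarrow> int) \<Rightarrow> mpoly \<Rightarrow> laurent" where
  "subst_powers a P = mpoly_subst (\<lambda>i. X_pow 0 (a i)) P"

definition laurent_eval :: "laurent \<Rightarrow> (nat \<Rightarrow> complex) \<Rightarrow> complex" where
  "laurent_eval R z =
     (\<Sum>u\<in>Poly_Mapping.keys R. Poly_Mapping.lookup R u *
        (\<Prod>i\<in>Poly_Mapping.keys u. z i powi Poly_Mapping.lookup u i))"

text \<open>
  Meant for nonzero \<open>R\<close> in the variables \<open>X\<^sub>i\<close>, \<open>i < n\<close>. The integrand is then integrable, and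
  the convention \<open>ln 0 = 0\<close> affects it on a null set only.
\<close>

definition mahler :: "nat \<Rightarrow> laurent \<Rightarrow> real" where
  "mahler n R =
     set_lebesgue_integral (\<Pi>\<^sub>M i\<in>{..<n}. lborel) (\<Pi>\<^sub>E i\<in>{..<n}. {0..<1})
       (\<lambda>x. ln (cmod (laurent_eval R (\<lambda>i. exp (2 * of_real pi * \<i> * of_real (x i))))))"

end

theory Submission
  imports Defs "HOL-Probability.Probability_Measure" "HOL-Computational_Algebra.Polynomial"
begin

text \<open>
  Let \<open>B\<close> be \<open>k\<close> times the largest absolute value of a coefficient of \<open>P\<close>, so that \<open>\<bar>P\<bar> \<le> B\<close> on
  the torus, and integrate \<open>ln \<bar>P\<bar> = ln B - 1/2 \<Sum>\<^sub>j (1 - \<bar>P\<bar>\<^sup>2/B\<^sup>2)\<^sup>j / j\<close>. The \<open>j\<close>-th summand is a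
  trigonometric polynomial with frequencies of norm at most \<open>j deg P\<close>, so restricting it to the line
  in direction \<open>a\<close> does not change its mean as long as \<open>j deg P < \<rho>(a)\<close>. The remaining terms are
  small for the line and for the torus, because \<open>\<bar>P\<bar>\<close> is seldom small: on a line in a direction that
  separates the monomials this is Lawton's estimate for polynomials with \<open>k\<close> terms, which does not
  depend on the direction, and the means over the torus are means over lines in the directions
  \<open>(1, N, N\<^sup>2, \<dots>)\<close> with \<open>N\<close> large.
\<close>

section \<open>Sublevel sets of sparse trigonometric polynomials\<close>

text \<open>The interval of length \<open>l\<close> that starts at the infimum of \<open>S\<close>
  covers \<open>S\<close>.\<close>

lemma emeasure_lborel_le_diameter:
  fixes S :: "real set"
  assumes "0 \<le> l" and "\<And>x y. x \<in> S \<Longrightarrow> y \<in> S \<Longrightarrow> x \<le> y \<Longrightarrow> y - x \<le> l"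
  shows "emeasure lborel S \<le> ennreal l"
proof (cases "S = {}")
  case False
  then obtain s where s: "s \<in> S" by blast
  have bdd: "bdd_below S"
    using assms(2)[OF _ s] assms(1) by (intro bdd_belowI[of _ "s - l"]) (smt (verit) s)
  have "S \<subseteq> {Inf S..Inf S + l}"
  proof
    fix x assume x: "x \<in> S"
    have "x - l \<le> Inf S"
      using s assms x by (intro cInf_greatest) (auto, smt (verit))
    with cInf_lower[OF x bdd] show "x \<in> {Inf S..Inf S + l}" by simp
  qed
  then have "emeasure lborel S \<le> emeasure lborel {Inf S..Inf S + l}"
    by (rule emeasure_mono) simp
  also have "\<dots> = ennreal l" using assms(1) by simp
  finally show ?thesis .
qed simp

text \<open>The points with |g'| = \<kappa> cut the interval into at most m + 1 pieces. Between two
  points of the set in one piece |g'| stays at least \<kappa>, so the mean value theorem bounds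
  their distance by 2 \<epsilon> / \<kappa>. The induction cuts at one such point at a time.\<close>

lemma emeasure_sublevel_le_card:
  fixes g g' :: "real \<Rightarrow> real"
  assumes deriv: "\<And>t. (g has_real_derivative g' t) (at t)"
    and cont: "continuous_on UNIV g'"
    and pos: "0 < \<kappa>" "0 < \<epsilon>"
    and fin: "finite {t\<in>{a<..<b}. \<bar>g' t\<bar> = \<kappa>}"
    and card: "card {t\<in>{a<..<b}. \<bar>g' t\<bar> = \<kappa>} \<le> m"
  shows "emeasure lborel {t\<in>{a..b}. \<bar>g t\<bar> < \<epsilon> \<and> \<bar>g' t\<bar> > \<kappa>} \<le> ennreal (real (Suc m) * (2 * \<epsilon> / \<kappa>))"
  using fin card
proof (induction m arbitrary: a b rule: less_induct)
  case (less m)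
  let ?Z = "\<lambda>a b. {t\<in>{a<..<b}. \<bar>g' t\<bar> = \<kappa>}"
  let ?S = "\<lambda>a b. {t\<in>{a..b}. \<bar>g t\<bar> < \<epsilon> \<and> \<bar>g' t\<bar> > \<kappa>}"
  have contg: "continuous_on UNIV g"
    by (meson DERIV_isCont continuous_at_imp_continuous_on deriv)
  have meas[measurable]: "?S a b \<in> sets borel" for a b
  proof -
    have [measurable]: "g \<in> borel_measurable borel" "g' \<in> borel_measurable borel"
      using contg cont by (auto intro: borel_measurable_continuous_onI)
    show ?thesis by measurable
  qed
  show ?case
  proof (cases "?Z a b = {}")
    case True
    have "emeasure lborel (?S a b) \<le> ennreal (2 * \<epsilon> / \<kappa>)"
    proof (rule emeasure_lborel_le_diameter)
      fix s t assume s: "s \<in> ?S a b" and t: "t \<in> ?S a b" and "s \<le> t"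
      show "t - s \<le> 2 * \<epsilon> / \<kappa>"
      proof (cases "s = t")
        case False
        with \<open>s \<le> t\<close> have st: "s < t" by simp
        obtain \<xi> where \<xi>: "s < \<xi>" "\<xi> < t" "g t - g s = (t - s) * g' \<xi>"
          using MVT2[OF st, of g g'] deriv by blast
        have "\<bar>g' \<xi>\<bar> \<ge> \<kappa>"
        proof (rule ccontr)
          assume "\<not> \<bar>g' \<xi>\<bar> \<ge> \<kappa>"
          moreover have "continuous_on {s..\<xi>} (\<lambda>x. \<bar>g' x\<bar>)"
            by (intro continuous_intros continuous_on_subset[OF cont]) simp
          ultimately obtain x where x: "s \<le> x" "x \<le> \<xi>" "\<bar>g' x\<bar> = \<kappa>"
            using IVT2'[of "\<lambda>x. \<bar>g' x\<bar>" \<xi> \<kappa> s] s \<xi> by force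
          \<comment> \<open>The point \<open>s\<close> may be the endpoint \<open>a\<close>, which
            the emptiness of the solution set does not control; the strict inequality at
            \<open>s\<close> excludes it.\<close>
          then have "x \<noteq> s" using s by force
          then have "x \<in> {a<..<b}" using s t \<xi> x by simp
          with x True show False by blast
        qed
        then have "\<kappa> * (t - s) \<le> \<bar>g t - g s\<bar>"
          using \<xi> st by (simp add: abs_mult mult.commute mult_left_mono)
        also have "\<dots> \<le> 2 * \<epsilon>" using s t by auto
        finally show ?thesis using pos by (simp add: field_simps)
      qed (use pos in simp)
    qed (use pos in simp)
    also have "\<dots> \<le> ennreal (real (Suc m) * (2 * \<epsilon> / \<kappa>))"
      using pos by (intro ennreal_leI) (simp add: field_simps)
    finally show ?thesis .
  next
    case False
    then obtain p where p: "p \<in> ?Z a b" by blast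
    have split: "?Z a b = insert p (?Z a p \<union> ?Z p b)" using p by auto
    have fin: "finite (?Z a p)" "finite (?Z p b)"
      using less.prems(1) unfolding split by simp_all
    have "card (?Z a b) = Suc (card (?Z a p) + card (?Z p b))"
      unfolding split using fin by (subst card_insert_disjoint) (auto intro!: card_Un_disjoint)
    \<comment> \<open>The cut point \<open>p\<close> belongs to neither half, so it pays for the
      additional piece: (m1 + 1) + (m2 + 1) is at most m + 1.\<close>
    with less.prems(2) obtain m1 m2 where m: "card (?Z a p) = m1" "card (?Z p b) = m2" "m1 + m2 < m"
      by auto
    have "emeasure lborel (?S a b) \<le> emeasure lborel (?S a p \<union> ?S p b)"
      by (rule emeasure_mono) (force, simp only: sets_lborel sets.Un meas)
    also have "\<dots> \<le> emeasure lborel (?S a p) + emeasure lborel (?S p b)"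
      by (intro emeasure_subadditive) (simp_all only: sets_lborel meas)
    also have "\<dots> \<le> ennreal (real (Suc m1) * (2 * \<epsilon> / \<kappa>)) + ennreal (real (Suc m2) * (2 * \<epsilon> / \<kappa>))"
      using m fin by (intro add_mono less.IH) auto
    also have "\<dots> = ennreal (real (Suc m1 + Suc m2) * (2 * \<epsilon> / \<kappa>))"
      using pos by (subst ennreal_plus[symmetric]) (simp_all add: add_divide_distrib ring_distribs)
    also have "\<dots> \<le> ennreal (real (Suc m) * (2 * \<epsilon> / \<kappa>))"
      using m pos by (intro ennreal_leI mult_right_mono) auto
    finally show ?thesis .
  qed
qed

text \<open>In terms of z = e^(2 pi i t), twice the real part minus 2 c, multiplied by z^N, is a
  polynomial of degree at most 2 N. Its coefficient at z^N is -2 c, because no frequency is 0, so it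
  is not the zero polynomial. Distinct t in [0,1) give distinct roots z.\<close>

lemma card_trig_solutions_le:
  fixes \<mu> :: "'a \<Rightarrow> int" and b :: "'a \<Rightarrow> complex" and c :: real
  assumes J: "finite J" and \<mu>: "\<And>l. l \<in> J \<Longrightarrow> \<mu> l \<noteq> 0" "\<And>l. l \<in> J \<Longrightarrow> \<bar>\<mu> l\<bar> \<le> int N" and "c \<noteq> 0"
  defines "Z \<equiv> {t\<in>{0..<1}. Re (\<Sum>l\<in>J. b l * cis (2 * pi * (\<mu> l * (t::real)))) = c}"
  shows "finite Z \<and> card Z \<le> 2 * N"
proof -
  define p :: "complex poly" where
    "p = (\<Sum>l\<in>J. monom (b l) (nat (int N + \<mu> l)) + monom (cnj (b l)) (nat (int N - \<mu> l)))
          - monom (complex_of_real (2 * c)) N"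
  have cisN: "cis (2 * pi * t) ^ nat (int N + m) = cis (2 * pi * t) ^ N * cis (2 * pi * (m * t))"
    if "\<bar>m\<bar> \<le> int N" for m and t :: real
  proof -
    have "real (nat (int N + m)) = real N + m" using that by simp
    then show ?thesis
      by (simp only: Complex.DeMoivre cis_mult) (simp add: algebra_simps)
  qed
  have ev: "poly p (cis (2 * pi * t))
      = cis (2 * pi * t) ^ N * of_real (2 * (Re (\<Sum>l\<in>J. b l * cis (2 * pi * (\<mu> l * t))) - c))" for t :: real
  proof -
    have "poly p (cis (2 * pi * t)) = (\<Sum>l\<in>J. cis (2 * pi * t) ^ N *
        (b l * cis (2 * pi * (\<mu> l * t)) + cnj (b l * cis (2 * pi * (\<mu> l * t)))))
        - of_real (2 * c) * cis (2 * pi * t) ^ N"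
      unfolding p_def poly_diff poly_sum poly_add poly_monom
    proof (intro arg_cong2[where f="(-)"] sum.cong refl)
      fix l assume "l \<in> J"
      with \<mu> show "b l * cis (2 * pi * t) ^ nat (int N + \<mu> l) + cnj (b l) * cis (2 * pi * t) ^ nat (int N - \<mu> l)
        = cis (2 * pi * t) ^ N * (b l * cis (2 * pi * (\<mu> l * t)) + cnj (b l * cis (2 * pi * (\<mu> l * t))))"
        using cisN[of "\<mu> l" t] cisN[of "- \<mu> l" t] by (simp add: cis_cnj algebra_simps)
    qed
    also have "\<dots> = cis (2 * pi * t) ^ N * of_real (2 * (Re (\<Sum>l\<in>J. b l * cis (2 * pi * (\<mu> l * t))) - c))"
      by (simp only: complex_add_cnj Re_sum of_real_mult of_real_diff of_real_sum sum_distrib_left[symmetric])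
        (simp add: algebra_simps sum_distrib_left)
    finally show ?thesis .
  qed
  have "coeff p N = - of_real (2 * c)"
  proof -
    have "nat (int N + \<mu> l) \<noteq> N \<and> nat (int N - \<mu> l) \<noteq> N" if "l \<in> J" for l
    proof -
      have "int (nat (int N + \<mu> l)) = int N + \<mu> l" "int (nat (int N - \<mu> l)) = int N - \<mu> l"
        using \<mu>(2)[OF that] by linarith+
      with \<mu>(1)[OF that] show ?thesis by linarith
    qed
    then show ?thesis by (simp add: p_def coeff_sum)
  qed
  then have "p \<noteq> 0" using \<open>c \<noteq> 0\<close> by auto
  have deg: "degree p \<le> 2 * N"
    unfolding p_def using \<mu>
    by (intro degree_diff_le degree_sum_le J degree_add_le order.trans[OF degree_monom_le]) force+
  let ?f = "\<lambda>t. cis (2 * pi * t)"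
  have inj: "inj_on ?f Z"
  proof (rule inj_onI)
    fix x y assume "x \<in> Z" "y \<in> Z" "?f x = ?f y"
    then have xy: "0 \<le> x" "x < 1" "0 \<le> y" "y < 1" by (auto simp: Z_def)
    from \<open>?f x = ?f y\<close> have "sin (2 * pi * x) = sin (2 * pi * y) \<and> cos (2 * pi * x) = cos (2 * pi * y)"
      by (auto simp: complex_eq_iff)
    then obtain n :: int where "2 * pi * x = 2 * pi * y + 2 * pi * n"
      unfolding sin_cos_eq_iff by auto
    then have "2 * pi * x = 2 * pi * (y + n)" by (simp add: algebra_simps)
    then have "x = y + n" by simp
    moreover from this xy have "\<bar>real_of_int n\<bar> < 1" by linarith
    then have "n = 0" by linarith
    ultimately show "x = y" by simp
  qed
  have sub: "?f ` Z \<subseteq> {z. poly p z = 0}"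
  proof clarify
    fix t assume "t \<in> Z"
    then have "Re (\<Sum>l\<in>J. b l * cis (2 * pi * (real_of_int (\<mu> l) * t))) = c"
      unfolding Z_def by blast
    then show "poly p (?f t) = 0" using ev[of t] by (simp del: Re_sum)
  qed
  have fin: "finite (?f ` Z)" by (rule finite_subset[OF sub poly_roots_finite[OF \<open>p \<noteq> 0\<close>]])
  then have "finite Z" by (rule finite_imageD[OF _ inj])
  moreover have "card Z \<le> 2 * N"
    using card_mono[OF poly_roots_finite[OF \<open>p \<noteq> 0\<close>] sub] card_poly_roots_bound[OF \<open>p \<noteq> 0\<close>] deg
      card_image[OF inj] by linarith
  ultimately show ?thesis by blast
qed

text \<open>The cut points of \<open>emeasure_sublevel_le_card\<close> solve g' = \<kappa> or g' =
  -\<kappa>, and each equation has at most 2 N solutions. The constant \<open>a0\<close>, which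
  differentiation kills, is kept apart so that the sum has nonzero frequencies only.\<close>

lemma emeasure_trig_sublevel_large_deriv:
  fixes \<mu> :: "'a \<Rightarrow> int" and b :: "'a \<Rightarrow> complex" and a0 :: real
  assumes J: "finite J" and \<mu>: "\<And>l. l \<in> J \<Longrightarrow> \<mu> l \<noteq> 0" "\<And>l. l \<in> J \<Longrightarrow> \<bar>\<mu> l\<bar> \<le> int N"
    and pos: "0 < \<kappa>" "0 < \<epsilon>"
  shows "emeasure lborel {t\<in>{0..<1::real}. \<bar>a0 + Re (\<Sum>l\<in>J. b l * cis (2 * pi * (\<mu> l * t)))\<bar> < \<epsilon> \<and>
      \<bar>Re (\<Sum>l\<in>J. b l * (2 * pi * \<mu> l * \<i>) * cis (2 * pi * (\<mu> l * t)))\<bar> > \<kappa>}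
    \<le> ennreal (real (Suc (4 * N)) * (2 * \<epsilon> / \<kappa>))"
proof -
  define g where "g t = a0 + Re (\<Sum>l\<in>J. b l * cis (2 * pi * (\<mu> l * t)))" for t :: real
  define g' where "g' t = Re (\<Sum>l\<in>J. b l * (2 * pi * \<mu> l * \<i>) * cis (2 * pi * (\<mu> l * t)))" for t :: real
  have deriv: "(g has_real_derivative g' t) (at t)" for t
    unfolding g_def g'_def Re_sum
    by (auto intro!: derivative_eq_intros sum.cong simp: algebra_simps)
  have cont: "continuous_on UNIV g'"
    unfolding g'_def by (intro continuous_intros)
  have sols: "finite {t\<in>{0..<1}. g' t = c} \<and> card {t\<in>{0..<1}. g' t = c} \<le> 2 * N" if "c \<noteq> 0" for c
    unfolding g'_def by (rule card_trig_solutions_le[OF J \<mu> that])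
  let ?Z = "{t\<in>{0<..<1}. \<bar>g' t\<bar> = \<kappa>}"
  let ?W = "{t\<in>{0..<1}. g' t = \<kappa>} \<union> {t\<in>{0..<1}. g' t = - \<kappa>}"
  have sub: "?Z \<subseteq> ?W" by auto
  have "finite ?W" using sols[of \<kappa>] sols[of "- \<kappa>"] pos by simp
  moreover have "card ?W \<le> 4 * N"
    using sols[of \<kappa>] sols[of "- \<kappa>"] pos
    by (intro order.trans[OF card_Un_le]) simp
  ultimately have "finite ?Z" "card ?Z \<le> 4 * N"
    using finite_subset[OF sub] order.trans[OF card_mono[OF _ sub]] by blast+
  then have "emeasure lborel {t\<in>{0..1}. \<bar>g t\<bar> < \<epsilon> \<and> \<bar>g' t\<bar> > \<kappa>} \<le> ennreal (real (Suc (4 * N)) * (2 * \<epsilon> / \<kappa>))"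
    by (intro emeasure_sublevel_le_card[OF deriv cont pos])
  moreover have "emeasure lborel {t\<in>{0..<1::real}. \<bar>g t\<bar> < \<epsilon> \<and> \<bar>g' t\<bar> > \<kappa>}
      \<le> emeasure lborel {t\<in>{0..1}. \<bar>g t\<bar> < \<epsilon> \<and> \<bar>g' t\<bar> > \<kappa>}"
  proof (rule emeasure_mono)
    have "continuous_on UNIV g"
      by (meson DERIV_isCont continuous_at_imp_continuous_on deriv)
    then have [measurable]: "g \<in> borel_measurable borel" "g' \<in> borel_measurable borel"
      using cont by (auto intro: borel_measurable_continuous_onI)
    show "{t\<in>{0..1}. \<bar>g t\<bar> < \<epsilon> \<and> \<bar>g' t\<bar> > \<kappa>} \<in> sets lborel" by measurable
  qed auto
  ultimately show ?thesis unfolding g_def g'_def by (rule order.trans[rotated])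
qed

text \<open>The case of one term: for \<delta> at most 1 the set is empty, otherwise \<delta>
  exceeds the length of the whole circle.\<close>

lemma emeasure_trig_sublevel_singleton:
  assumes "1 \<le> cmod c" and "0 < \<delta>"
  shows "emeasure lborel {t\<in>{0..<1::real}. cmod (c * cis (f t)) < \<delta> ^ k} \<le> ennreal \<delta>"
proof (cases "\<delta> \<le> 1")
  case True
  then have "\<delta> ^ k \<le> 1" using assms by (simp add: power_le_one)
  then have "{t\<in>{0..<1::real}. cmod (c * cis (f t)) < \<delta> ^ k} = {}"
    using assms by (auto simp: norm_mult)
  then show ?thesis by (simp only: emeasure_empty zero_le)
next
  case False
  have "emeasure lborel {t\<in>{0..<1::real}. cmod (c * cis (f t)) < \<delta> ^ k} \<le> emeasure lborel {0..<1::real}"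
    by (rule emeasure_mono) auto
  also have "\<dots> \<le> ennreal \<delta>" using False by (simp add: ennreal_leI flip: ennreal_1)
  finally show ?thesis .
qed

text \<open>
  Lawton's estimate, uniform in the frequencies. Dividing by the term \<open>i\<close> whose frequency is
  farthest from that of \<open>j\<close> and differentiating removes a term, and the coefficient of \<open>j\<close> grows
  by a factor comparable to the length of the spectrum, hence to the number of oscillations.
\<close>

lemma emeasure_trig_sublevel_le:
  fixes \<nu> :: "'a \<Rightarrow> int" and c :: "'a \<Rightarrow> complex"
  assumes "finite I" "card I \<le> Suc k" "inj_on \<nu> I" "j \<in> I" "1 \<le> cmod (c j)" "0 < \<delta>"
  shows "emeasure lborel {t\<in>{0..<1::real}. cmod (\<Sum>i\<in>I. c i * cis (2 * pi * (\<nu> i * t))) < \<delta> ^ k}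
    \<le> ennreal (real (Suc (12 * k)) * \<delta>)"
  using assms
proof (induction k arbitrary: I c \<nu>)
  case 0
  then have "I = {j}"
    by (metis One_nat_def card_0_eq card_1_singletonE empty_iff le_SucE le_zero_eq singletonD)
  then show ?case using emeasure_trig_sublevel_singleton[of "c j" \<delta> "\<lambda>t. 2 * pi * (\<nu> j * t)" 0] 0 by simp
next
  case (Suc k)
  note fin = \<open>finite I\<close> and j = \<open>j \<in> I\<close> and \<delta> = \<open>0 < \<delta>\<close>
  show ?case
  proof (cases "I = {j}")
    case True
    have "emeasure lborel {t\<in>{0..<1::real}. cmod (\<Sum>i\<in>I. c i * cis (2 * pi * (\<nu> i * t))) < \<delta> ^ Suc k} \<le> ennreal \<delta>"
      using emeasure_trig_sublevel_singleton[of "c j" \<delta> "\<lambda>t. 2 * pi * (\<nu> j * t)" "Suc k"] Suc.prems True by simp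
    also have "\<dots> \<le> ennreal (real (Suc (12 * Suc k)) * \<delta>)"
      using \<delta> by (intro ennreal_leI) simp
    finally show ?thesis .
  next
    case False
    with j have ne: "I - {j} \<noteq> {}" by blast
    \<comment> \<open>The term \<open>j\<close> stays in the sum throughout the induction, the term
      \<open>i\<close> is the one removed. Choosing \<open>i\<close> farthest from \<open>j\<close>
      makes |\<mu> j| = M, while every |\<mu> l| is at most 2 M.\<close>
    define M where "M = Max ((\<lambda>i. \<bar>\<nu> i - \<nu> j\<bar>) ` I)"
    have "M \<in> (\<lambda>i. \<bar>\<nu> i - \<nu> j\<bar>) ` I"
      unfolding M_def using fin j by (intro Max_in) auto
    then obtain i where i: "i \<in> I" "M = \<bar>\<nu> i - \<nu> j\<bar>" by blast
    have Mge: "\<bar>\<nu> l - \<nu> j\<bar> \<le> M" if "l \<in> I" for l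
      unfolding M_def using fin that by (intro Max_ge) auto
    obtain l where l: "l \<in> I" "l \<noteq> j" using ne by blast
    have "\<nu> l \<noteq> \<nu> j" using l j \<open>inj_on \<nu> I\<close> by (auto dest: inj_onD)
    with Mge[OF l(1)] have M: "1 \<le> M" by linarith
    with i have "i \<noteq> j" by auto
    define J where "J = I - {i}"
    have J: "finite J" "card J \<le> Suc k" "j \<in> J" "J \<subseteq> I"
      using fin i \<open>i \<noteq> j\<close> j Suc.prems(2) by (auto simp: J_def)
    define \<mu> where "\<mu> l = \<nu> l - \<nu> i" for l
    have \<mu>0: "\<mu> l \<noteq> 0" if "l \<in> J" for l
      using that i \<open>inj_on \<nu> I\<close> unfolding J_def \<mu>_def by (auto dest: inj_onD)
    have \<mu>le: "\<bar>\<mu> l\<bar> \<le> int (nat (2 * M))" if "l \<in> J" for l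
    proof -
      have "\<bar>\<mu> l\<bar> \<le> \<bar>\<nu> l - \<nu> j\<bar> + \<bar>\<nu> i - \<nu> j\<bar>" unfolding \<mu>_def by linarith
      also have "\<dots> \<le> M + M" using that J(4) Mge i(1) by (intro add_mono) auto
      finally show ?thesis using M by simp
    qed
    have inj: "inj_on \<mu> J"
      using \<open>inj_on \<nu> I\<close> J(4) by (auto simp: inj_on_def \<mu>_def)
    \<comment> \<open>These are the coefficients of the derivative divided by 2 pi i M. With this
      scaling the coefficient of \<open>j\<close> keeps its modulus, as the induction hypothesis
      requires.\<close>
    define c' where "c' l = c l * (real_of_int (\<mu> l) / real_of_int M)" for l
    have "\<bar>real_of_int (\<mu> j)\<bar> = M" using i by (simp add: \<mu>_def abs_minus_commute flip: of_int_abs)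
    then have c'j: "1 \<le> cmod (c' j)"
      using \<open>1 \<le> cmod (c j)\<close> M by (simp add: c'_def norm_mult norm_divide)
    \<comment> \<open>If the real and imaginary parts of the derivative are at most \<kappa> in
      absolute value, its modulus is at most 2 \<kappa> = 6 M \<delta>^k, which is less than 2 pi M
      \<delta>^k as pi > 3. Then the rescaled derivative is below \<delta>^k, and the induction
      hypothesis covers such t.\<close>
    define \<kappa> where "\<kappa> = 3 * real_of_int M * \<delta> ^ k"
    define H' where "H' b t = (\<Sum>l\<in>J. b l * (2 * pi * \<mu> l * \<i>) * cis (2 * pi * (\<mu> l * t)))" for b and t :: real
    define H where "H b t = (\<Sum>l\<in>J. b l * cis (2 * pi * (\<mu> l * t)))" for b and t :: real
    let ?E = "{t\<in>{0..<1}. cmod (H c' t) < \<delta> ^ k}"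
    \<comment> \<open>The factors \<theta> = 1 and \<theta> = -i turn the estimate for real parts
      into one for the real and one for the imaginary part.\<close>
    let ?F = "\<lambda>\<theta>. {t\<in>{0..<1}. \<bar>Re (\<theta> * c i) + Re (H (\<lambda>l. \<theta> * c l) t)\<bar> < \<delta> ^ Suc k \<and> \<bar>Re (H' (\<lambda>l. \<theta> * c l) t)\<bar> > \<kappa>}"
    have contH: "continuous_on UNIV (H b)" "continuous_on UNIV (H' b)" for b
      unfolding H_def[abs_def] H'_def[abs_def] by (intro continuous_intros)+
    have [measurable]: "H b \<in> borel_measurable borel" "H' b \<in> borel_measurable borel" for b
      using contH by (auto intro: borel_measurable_continuous_onI)
    have mE: "?E \<in> sets borel" by measurable
    have mF: "?F \<theta> \<in> sets borel" for \<theta> by measurable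
    have sub: "{t\<in>{0..<1}. cmod (\<Sum>i\<in>I. c i * cis (2 * pi * (\<nu> i * t))) < \<delta> ^ Suc k} \<subseteq> ?E \<union> (?F 1 \<union> ?F (- \<i>))"
    proof (rule subsetI, rule ccontr)
      fix t :: real
      assume "t \<in> {t\<in>{0..<1}. cmod (\<Sum>i\<in>I. c i * cis (2 * pi * (\<nu> i * t))) < \<delta> ^ Suc k}"
        and "t \<notin> ?E \<union> (?F 1 \<union> ?F (- \<i>))"
      then have t: "t \<in> {0..<1}" and less: "cmod (\<Sum>i\<in>I. c i * cis (2 * pi * (\<nu> i * t))) < \<delta> ^ Suc k"
        and notF: "t \<notin> ?E" "t \<notin> ?F 1" "t \<notin> ?F (- \<i>)"
        by blast+
      have "(\<Sum>i\<in>I. c i * cis (2 * pi * (\<nu> i * t))) = cis (2 * pi * (\<nu> i * t)) * (c i + H c t)"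
      proof -
        have "c l * cis (2 * pi * (\<nu> l * t)) = cis (2 * pi * (\<nu> i * t)) * (c l * cis (2 * pi * (\<mu> l * t)))" for l
          unfolding mult.left_commute[of _ "c l"] cis_mult by (simp add: \<mu>_def algebra_simps)
        then have "(\<Sum>l\<in>I. c l * cis (2 * pi * (\<nu> l * t))) = cis (2 * pi * (\<nu> i * t)) * (\<Sum>l\<in>I. c l * cis (2 * pi * (\<mu> l * t)))"
          unfolding sum_distrib_left by (intro sum.cong) auto
        also have "(\<Sum>l\<in>I. c l * cis (2 * pi * (\<mu> l * t))) = c i + H c t"
          unfolding H_def J_def using sum.remove[OF fin i(1), of "\<lambda>l. c l * cis (2 * pi * (\<mu> l * t))"]
          by (simp add: \<mu>_def)
        finally show ?thesis .
      qed
      with less have less': "cmod (c i + H c t) < \<delta> ^ Suc k" by (simp add: norm_mult)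
      have scale: "H (\<lambda>l. \<theta> * c l) t = \<theta> * H c t" "H' (\<lambda>l. \<theta> * c l) t = \<theta> * H' c t" for \<theta>
        unfolding H_def H'_def sum_distrib_left by (simp_all add: mult.assoc)
      have "\<bar>Re (c i + H c t)\<bar> < \<delta> ^ Suc k" "\<bar>Im (c i + H c t)\<bar> < \<delta> ^ Suc k"
        using less' abs_Re_le_cmod abs_Im_le_cmod order.strict_trans1 by blast+
      moreover have F_iff: "t \<in> ?F \<theta> \<longleftrightarrow> \<bar>Re (\<theta> * (c i + H c t))\<bar> < \<delta> ^ Suc k \<and> \<bar>Re (\<theta> * H' c t)\<bar> > \<kappa>" for \<theta>
        using t by (simp only: scale mem_Collect_eq distrib_left plus_complex.sel simp_thms)
      ultimately have "\<bar>Re (H' c t)\<bar> \<le> \<kappa>" "\<bar>Im (H' c t)\<bar> \<le> \<kappa>"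
        using notF(2,3) unfolding F_iff by (auto simp: not_less add.commute simp del: power_Suc)
      then have "cmod (H' c t) \<le> 2 * \<kappa>" using cmod_le[of "H' c t"] by linarith
      moreover have "H' c t = 2 * pi * M * \<i> * H c' t"
        unfolding H_def H'_def c'_def sum_distrib_left using M by (intro sum.cong) auto
      ultimately have "2 * pi * M * cmod (H c' t) \<le> 2 * M * (3 * \<delta> ^ k)"
        using M by (simp add: norm_mult \<kappa>_def algebra_simps)
      also have "\<dots> < 2 * M * (pi * \<delta> ^ k)"
        using pi_gt3 \<delta> M by (intro mult_strict_left_mono mult_strict_right_mono) auto
      finally have "cmod (H c' t) < \<delta> ^ k" using M by (simp add: algebra_simps)
      with t notF(1) show False by blast
    qed
    have F: "emeasure lborel (?F \<theta>) \<le> ennreal (6 * \<delta>)" for \<theta>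
    proof -
      have "emeasure lborel (?F \<theta>) \<le> ennreal (real (Suc (4 * nat (2 * M))) * (2 * \<delta> ^ Suc k / \<kappa>))"
        unfolding H_def H'_def using M \<delta>
        by (intro emeasure_trig_sublevel_large_deriv J \<mu>0 \<mu>le) (auto simp: \<kappa>_def)
      \<comment> \<open>Here 8 M + 1 is at most 9 M because M is at least 1. The M cancels against
        the one in \<kappa>, which makes the bound independent of the frequencies. The two sets
        \<open>?F\<close> together add 12 \<delta> in each step.\<close>
      also have "real (Suc (4 * nat (2 * M))) * (2 * \<delta> ^ Suc k / \<kappa>) \<le> (9 * M) * (2 * \<delta> ^ Suc k / \<kappa>)"
        using M \<delta> by (intro mult_right_mono) (auto simp: \<kappa>_def)
      also have "\<dots> = 6 * \<delta>" using M \<delta> by (simp add: \<kappa>_def field_simps)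
      finally show ?thesis by (simp add: ennreal_leI)
    qed
    have "emeasure lborel {t\<in>{0..<1::real}. cmod (\<Sum>i\<in>I. c i * cis (2 * pi * (\<nu> i * t))) < \<delta> ^ Suc k}
        \<le> emeasure lborel (?E \<union> (?F 1 \<union> ?F (- \<i>)))"
      using mE mF by (intro emeasure_mono sub) (simp only: sets_lborel sets.Un)
    also have "\<dots> \<le> emeasure lborel ?E + (emeasure lborel (?F 1) + emeasure lborel (?F (- \<i>)))"
      using mE mF by (intro order.trans[OF emeasure_subadditive] add_left_mono) (simp_all only: sets_lborel sets.Un)
    also have "\<dots> \<le> ennreal (real (Suc (12 * k)) * \<delta>) + (ennreal (6 * \<delta>) + ennreal (6 * \<delta>))"
      unfolding H_def by (intro add_mono F[unfolded H_def] Suc.IH J inj c'j \<delta>)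
    also have "\<dots> = ennreal (real (Suc (12 * Suc k)) * \<delta>)"
      using \<delta> by (simp add: algebra_simps flip: ennreal_plus)
    finally show ?thesis .
  qed
qed

section \<open>Logarithmic integrals from moments\<close>

text \<open>Bernoulli's inequality bounds n x by (1 + x)^n, and (1 - x) (1 + x) is at most
  1.\<close>

lemma one_minus_power_mult_le_one:
  fixes x :: real
  assumes "0 \<le> x" "x \<le> 1"
  shows "(1 - x) ^ n * (n * x) \<le> 1"
proof -
  have "(1 - x) ^ n * (n * x) \<le> (1 - x) ^ n * (1 + x) ^ n"
    using Bernoulli_inequality[of x n] assms by (intro mult_left_mono) auto
  also have "\<dots> = (1 - x\<^sup>2) ^ n"
    by (simp add: power2_eq_square algebra_simps flip: power_mult_distrib)
  also have "\<dots> \<le> 1" using assms by (intro power_le_one) (auto simp: power_le_one)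
  finally show ?thesis .
qed

text \<open>
  Integrates \<open>ln (f/B) = - 1/2 \<Sum>\<^sub>j (1 - (f/B)\<^sup>2)\<^sup>j / j\<close> termwise; the summand \<open>j = 0\<close> vanishes
  because \<open>x / 0 = 0\<close>.
\<close>

lemma (in prob_space) expectation_ln_partial_sum:
  fixes f :: "'a \<Rightarrow> real" and A B s :: real
  assumes meas[measurable]: "f \<in> borel_measurable M"
    and bounds: "\<And>x. x \<in> space M \<Longrightarrow> 0 \<le> f x" "\<And>x. x \<in> space M \<Longrightarrow> f x \<le> B"
    and "0 < B" "0 < s"
    and moments: "\<And>n. 1 \<le> n \<Longrightarrow> expectation (\<lambda>x. (1 - (f x / B)\<^sup>2) ^ n) \<le> A * real n powr (- 2 * s)"
  shows "\<bar>expectation (\<lambda>x. ln (f x)) - (ln B - (\<Sum>j<Suc n. expectation (\<lambda>x. (1 - (f x / B)\<^sup>2) ^ j) / j) / 2)\<bar>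
    \<le> A * suminf (\<lambda>j. real (Suc j) powr (- 1 - s)) * real (Suc n) powr (- s)"
proof -
  define u where "u x = 1 - (f x / B)\<^sup>2" for x
  define m where "m j = expectation (\<lambda>x. u x ^ j)" for j
  have [measurable]: "u \<in> borel_measurable M" unfolding u_def by measurable
  have u01: "0 \<le> u x" "u x \<le> 1" if "x \<in> space M" for x
    using bounds[OF that] \<open>0 < B\<close> by (auto simp: u_def power_le_one)
  have int: "integrable M (\<lambda>x. u x ^ j)" for j
    using u01 by (intro integrable_const_bound[where B = 1]) (auto simp: power_le_one)
  have m_nonneg: "0 \<le> m j" for j
    unfolding m_def using u01 by (intro integral_nonneg_AE) auto
  have m_le: "m j \<le> A * real j powr (- 2 * s)" if "1 \<le> j" for j
    using moments[OF that] by (simp add: m_def u_def)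
  have "0 \<le> A" using m_nonneg[of 1] m_le[of 1] by simp
  \<comment> \<open>On the zero set of \<open>f\<close> all powers of \<open>u\<close> equal 1, so
    its probability is at most every moment, and the moments tend to 0. This discards the points
    where the series diverges while \<open>ln\<close> has its default value 0.\<close>
  have "prob {x\<in>space M. f x = 0} \<le> m n" for n
  proof -
    have "expectation (indicator {x\<in>space M. f x = 0}) \<le> m n"
      unfolding m_def
    proof (intro integral_mono int)
      fix x assume "x \<in> space M"
      then show "indicator {x\<in>space M. f x = 0} x \<le> u x ^ n"
        using u01[of x] by (auto simp: indicator_def u_def)
    next
      have "{x\<in>space M. f x = 0} \<in> sets M" by measurable
      then show "integrable M (indicat_real {x\<in>space M. f x = 0})" by (simp add: emeasure_eq_measure)
    qed
    then show ?thesis by simp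
  qed
  then have "prob {x\<in>space M. f x = 0} \<le> A * real n powr (- 2 * s)" if "1 \<le> n" for n
    using m_le[OF that] by (rule order.trans)
  moreover have "(\<lambda>n. A * real n powr (- 2 * s)) \<longlonglongrightarrow> A * 0"
    using \<open>0 < s\<close> by (intro tendsto_intros tendsto_neg_powr filterlim_real_sequentially) auto
  ultimately have "prob {x\<in>space M. f x = 0} \<le> 0"
    by (intro tendsto_lowerbound[of _ _ sequentially]) (auto intro: eventually_sequentiallyI[of 1])
  then have "prob {x\<in>space M. f x = 0} = 0"
    by (rule antisym) simp
  moreover have "{x\<in>space M. f x = 0} \<in> events" by measurable
  ultimately have "AE x in M. x \<notin> {x\<in>space M. f x = 0}"
    using prob_eq_0 by blast
  then have pos: "AE x in M. 0 < f x"
    using AE_space by eventually_elim (use bounds(1) in force)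
  define h where "h j x = u x ^ j / real j" for j x
  have h_sums: "(\<lambda>j. h j x) sums (- 2 * ln (f x / B))" if "x \<in> space M" "0 < f x" for x
  proof -
    have "u x < 1" using that \<open>0 < B\<close> by (simp add: u_def)
    \<comment> \<open>The logarithmic series at -u x; since 1 - u x = (f x / B)^2, its sum is 2 ln
      (f x / B).\<close>
    then have "(\<lambda>n. - ((- (- u x)) ^ n) / of_nat n) sums ln (1 + - u x)"
      using u01[OF that(1)] by (intro ln_series') auto
    then have "(\<lambda>j. - h j x) sums (2 * ln (f x / B))"
      using that \<open>0 < B\<close> by (simp add: h_def u_def ln_realpow)
    from sums_minus[OF this] show ?thesis by simp
  qed
  have h_nonneg: "0 \<le> h j x" if "x \<in> space M" for j x
    using u01[OF that] by (simp add: h_def)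
  have h_int: "integrable M (h j)" for j
    unfolding h_def using int by simp
  have h_exp: "expectation (h j) = m j / j" for j
    unfolding h_def[abs_def] m_def by simp
  have s1: "summable (\<lambda>j. real (Suc j) powr (- 1 - s))"
    using summable_real_powr_iff[of "- 1 - s"] \<open>0 < s\<close> by (subst summable_Suc_iff) simp
  \<comment> \<open>The exponent -1 - 2 s is split into -s and -1 - s. In the first factor j + n + 1
    is replaced by n + 1, in the second by j + 1: the sum over j converges and a decaying factor in
    n remains.\<close>
  have tail_le: "m (j + Suc n) / (j + Suc n) \<le> A * (real (Suc n) powr (- s) * real (Suc j) powr (- 1 - s))" for j n
  proof -
    have "m (j + Suc n) / (j + Suc n) \<le> A * real (j + Suc n) powr (- 2 * s) / (j + Suc n)"
      by (intro divide_right_mono m_le) auto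
    also have "\<dots> = A * (real (j + Suc n) powr (- s) * real (j + Suc n) powr (- 1 - s))"
      by (simp add: powr_diff powr_minus powr_add[symmetric] field_simps)
    also have "\<dots> \<le> A * (real (Suc n) powr (- s) * real (Suc j) powr (- 1 - s))"
      using \<open>0 \<le> A\<close> \<open>0 < s\<close> by (intro mult_left_mono mult_mono powr_mono2') auto
    finally show ?thesis .
  qed
  have summ: "summable (\<lambda>j. m j / j)"
  proof (subst summable_iff_shift[of _ 1, symmetric], rule summable_comparison_test')
    show "summable (\<lambda>j. A * (real (Suc 0) powr (- s) * real (Suc j) powr (- 1 - s)))"
      by (intro summable_mult s1)
    show "norm (m (j + 1) / real (j + 1)) \<le> A * (real (Suc 0) powr (- s) * real (Suc j) powr (- 1 - s))" for j
      using tail_le[of j 0] m_nonneg by simp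
  qed
  have AE_sums: "AE x in M. (\<lambda>j. h j x) sums (- 2 * ln (f x / B))"
    using pos h_sums by (auto elim: AE_mp)
  have normh: "expectation (\<lambda>x. norm (h j x)) = m j / j" for j
    unfolding h_exp[symmetric] using h_nonneg by (intro Bochner_Integration.integral_cong) auto
  have AE_summable: "AE x in M. summable (\<lambda>j. norm (h j x))"
    using AE_sums AE_space by eventually_elim (auto simp: h_nonneg dest: sums_summable)
  have AE_suminf: "AE x in M. suminf (\<lambda>j. h j x) = - 2 * ln (f x / B)"
    using AE_sums by eventually_elim (rule sums_unique[symmetric])
  \<comment> \<open>The expectations of the nonnegative terms have a convergent sum, which permits
    exchanging sum and expectation and gives the integrability of the logarithm.\<close>
  have "integrable M (\<lambda>x. suminf (\<lambda>j. h j x))"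
    using h_int AE_summable summ unfolding normh[symmetric] by (rule integrable_suminf)
  then have int_ln: "integrable M (\<lambda>x. - 2 * ln (f x / B))"
    using AE_suminf by (subst integrable_cong_AE[of _ _ "\<lambda>x. suminf (\<lambda>j. h j x)"]) (auto intro: borel_measurable_integrable)
  have "suminf (\<lambda>j. m j / j) = expectation (\<lambda>x. suminf (\<lambda>j. h j x))"
    unfolding h_exp[symmetric]
    using h_int AE_summable summ unfolding normh[symmetric] by (rule integral_suminf[symmetric])
  also have "\<dots> = expectation (\<lambda>x. - 2 * ln (f x / B))"
    using AE_suminf int_ln \<open>integrable M (\<lambda>x. suminf (\<lambda>j. h j x))\<close>
    by (intro integral_cong_AE) (auto intro: borel_measurable_integrable)
  finally have series: "suminf (\<lambda>j. m j / j) = - 2 * expectation (\<lambda>x. ln (f x / B))" by simp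
  have "expectation (\<lambda>x. ln (f x)) = expectation (\<lambda>x. ln B + ln (f x / B))"
  proof (rule integral_cong_AE)
    show "AE x in M. ln (f x) = ln B + ln (f x / B)"
      using pos by eventually_elim (use \<open>0 < B\<close> in \<open>simp add: ln_div\<close>)
  qed simp_all
  also have "\<dots> = ln B + expectation (\<lambda>x. ln (f x / B))"
    using int_ln by (subst Bochner_Integration.integral_add) (auto simp: prob_space)
  finally have "expectation (\<lambda>x. ln (f x)) = ln B - suminf (\<lambda>j. m j / j) / 2"
    using series by simp
  moreover have "suminf (\<lambda>j. m j / j) = suminf (\<lambda>j. m (j + Suc n) / (j + Suc n)) + (\<Sum>j<Suc n. m j / j)"
    using suminf_split_initial_segment[OF summ, of "Suc n"] by simp
  moreover have "0 \<le> suminf (\<lambda>j. m (j + Suc n) / (j + Suc n))"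
    using m_nonneg summable_ignore_initial_segment[OF summ, of "Suc n"] by (intro suminf_nonneg) simp_all
  moreover have "suminf (\<lambda>j. m (j + Suc n) / (j + Suc n))
      \<le> suminf (\<lambda>j. A * (real (Suc n) powr (- s) * real (Suc j) powr (- 1 - s)))"
    using summable_ignore_initial_segment[OF summ, of "Suc n"]
    by (intro suminf_le tail_le summable_mult s1) auto
  moreover have "\<dots> = A * suminf (\<lambda>j. real (Suc j) powr (- 1 - s)) * real (Suc n) powr (- s)"
    using s1 by (simp add: suminf_mult summable_mult del: of_nat_Suc)
  ultimately have "\<bar>expectation (\<lambda>x. ln (f x)) - (ln B - (\<Sum>j<Suc n. m j / j) / 2)\<bar>
      \<le> A * suminf (\<lambda>j. real (Suc j) powr (- 1 - s)) * real (Suc n) powr (- s)"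
    by linarith
  then show ?thesis unfolding m_def u_def .
qed

section \<open>Moments on the circle\<close>

definition unit_circle :: "real measure" where
  "unit_circle = restrict_space lborel {0..<1}"

lemma space_unit_circle: "space unit_circle = {0..<1}"
  by (simp add: unit_circle_def space_restrict_space)

lemma prob_space_unit_circle: "prob_space unit_circle"
  unfolding unit_circle_def by (rule prob_space_restrict_space) auto

text \<open>The circle is split along the set where the sum is smaller than L \<delta>^k in modulus,
  with \<delta> = n^(-1/(4k)). By Lawton's estimate that set has measure at most (12 k + 1)
  \<delta>. Outside it the integrand is at most (1 - x)^n with n x = n^(1/2) / (k+1)^2, and
  \<open>one_minus_power_mult_le_one\<close> bounds this by (k+1)^2 n^(-1/2), which is at most
  (k+1)^2 \<delta>.\<close>

lemma integral_trig_moment_le: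
  fixes \<nu> :: "'a \<Rightarrow> int" and c :: "'a \<Rightarrow> complex" and L :: real
  assumes I: "finite I" "card I \<le> Suc k" "inj_on \<nu> I"
    and c: "j \<in> I" "cmod (c j) = L" "\<And>i. i \<in> I \<Longrightarrow> cmod (c i) \<le> L" and "0 < L" and "1 \<le> k" and "1 \<le> n"
  shows "integral\<^sup>L unit_circle (\<lambda>t. (1 - (cmod (\<Sum>i\<in>I. c i * cis (2 * pi * (\<nu> i * t))) / (Suc k * L))\<^sup>2) ^ n)
    \<le> (Suc (12 * k) + (Suc k)\<^sup>2) * real n powr (- (1 / (4 * k)))"
proof -
  interpret prob_space unit_circle by (rule prob_space_unit_circle)
  define Q where "Q t = (\<Sum>i\<in>I. c i * cis (2 * pi * (\<nu> i * t)))" for t :: real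
  define v where "v t = 1 - (cmod (Q t) / (Suc k * L))\<^sup>2" for t
  define \<delta> where "\<delta> = real n powr (- (1 / (4 * k)))"
  define E where "E = {t\<in>{0..<1}. cmod (Q t) < L * \<delta> ^ k}"
  have \<delta>: "0 < \<delta>" "\<delta> \<le> 1"
    using \<open>1 \<le> n\<close> powr_mono[of "- (1 / (4 * k))" 0 "real n"] by (simp_all add: \<delta>_def)
  have "continuous_on UNIV Q" unfolding Q_def[abs_def] by (intro continuous_intros)
  then have Qb[measurable]: "Q \<in> borel_measurable borel" by (rule borel_measurable_continuous_onI)
  have Eb[measurable]: "E \<in> sets borel" unfolding E_def by measurable
  have Q_le: "cmod (Q t) \<le> Suc k * L" for t
  proof -
    have "cmod (Q t) \<le> (\<Sum>i\<in>I. L)"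
      unfolding Q_def using c(3) by (intro sum_norm_le) (auto simp: norm_mult)
    also have "\<dots> \<le> Suc k * L" using I(2) \<open>0 < L\<close> by (simp add: mult_right_mono)
    finally show ?thesis .
  qed
  have v01: "0 \<le> v t" "v t \<le> 1" for t
    using Q_le[of t] \<open>0 < L\<close> by (auto simp: v_def power_le_one divide_le_eq_1)
  have [measurable]: "v \<in> borel_measurable borel" unfolding v_def by measurable
  have [measurable]: "v \<in> borel_measurable unit_circle" "E \<in> sets unit_circle"
    using Eb by (auto simp: unit_circle_def E_def sets_restrict_space_iff intro: measurable_restrict_space1)
  have prob_E: "prob E \<le> Suc (12 * k) * \<delta>"
  proof -
    have "E = {t\<in>{0..<1}. cmod (\<Sum>i\<in>I. (c i / L) * cis (2 * pi * (\<nu> i * t))) < \<delta> ^ k}"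
      using \<open>0 < L\<close> by (simp add: E_def Q_def norm_divide field_simps flip: sum_divide_distrib)
    then have "emeasure lborel E \<le> ennreal (Suc (12 * k) * \<delta>)"
      using I c \<open>0 < L\<close> \<delta> emeasure_trig_sublevel_le[of I k \<nu> j "\<lambda>i. c i / L" \<delta>] by (simp add: norm_divide)
    moreover have "emeasure unit_circle E = emeasure lborel E"
      unfolding unit_circle_def by (rule emeasure_restrict_space) (auto simp: E_def)
    ultimately have "ennreal (prob E) \<le> ennreal (Suc (12 * k) * \<delta>)"
      by (simp only: emeasure_eq_measure)
    then show ?thesis using \<delta> by (subst (asm) ennreal_le_iff) auto
  qed
  define x where "x = (\<delta> ^ k / Suc k)\<^sup>2"
  have "\<delta> ^ k \<le> 1" using \<delta> by (simp add: power_le_one)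
  then have "\<delta> ^ k / Suc k \<le> 1" by (simp add: divide_le_eq)
  then have x01: "0 \<le> x" "x \<le> 1" using \<delta> unfolding x_def by (auto simp: power_le_one)
  have "\<delta> ^ (2 * k) = real n powr (- (1 / 2))"
    using \<open>1 \<le> k\<close> \<open>1 \<le> n\<close> by (simp add: \<delta>_def powr_power)
  then have "real n * x = real n powr (1 / 2) / (Suc k)\<^sup>2"
    using \<open>1 \<le> n\<close> powr_add[of "real n" 1 "- (1 / 2)"]
    by (simp add: x_def power_divide mult.commute[of 2] flip: power_mult)
  then have "(1 - x) ^ n * (real n powr (1 / 2) / (Suc k)\<^sup>2) \<le> 1"
    using one_minus_power_mult_le_one[OF x01, of n] by simp
  then have "(1 - x) ^ n \<le> (Suc k)\<^sup>2 * real n powr (- (1 / 2))"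
    using \<open>1 \<le> n\<close> by (simp add: powr_minus field_simps)
  also have "\<dots> \<le> (Suc k)\<^sup>2 * \<delta>"
    unfolding \<delta>_def using \<open>1 \<le> k\<close> \<open>1 \<le> n\<close> by (intro mult_left_mono powr_mono) (auto simp: field_simps)
  finally have x_le: "(1 - x) ^ n \<le> (Suc k)\<^sup>2 * \<delta>" .
  have "expectation (\<lambda>t. v t ^ n) \<le> expectation (\<lambda>t. indicator E t + (1 - x) ^ n)"
  proof (rule integral_mono)
    show "integrable unit_circle (\<lambda>t. v t ^ n)"
      using v01 by (intro integrable_const_bound[where B = 1]) (auto simp: power_le_one)
    show "integrable unit_circle (\<lambda>t. indicator E t + (1 - x) ^ n)"
      by (intro Bochner_Integration.integrable_add integrable_const) (simp add: emeasure_eq_measure)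
    fix t assume t: "t \<in> space unit_circle"
    show "v t ^ n \<le> indicator E t + (1 - x) ^ n"
    proof (cases "t \<in> E")
      case True
      then show ?thesis using v01[of t] x01 by (simp add: power_le_one add_increasing2)
    next
      case False
      then have "L * \<delta> ^ k \<le> cmod (Q t)" using t by (auto simp: E_def space_unit_circle not_less)
      then have "\<delta> ^ k \<le> cmod (Q t) / L" using \<open>0 < L\<close> by (simp add: field_simps)
      then have "\<delta> ^ k / Suc k \<le> cmod (Q t) / L / Suc k" by (rule divide_right_mono) simp
      then have "\<delta> ^ k / Suc k \<le> cmod (Q t) / (Suc k * L)"
        by (simp only: divide_divide_eq_left mult.commute)
      then have "x \<le> (cmod (Q t) / (Suc k * L))\<^sup>2"
        unfolding x_def using \<delta> by (intro power_mono) auto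
      then have "v t \<le> 1 - x" by (simp add: v_def)
      then show ?thesis using False v01[of t] by (simp add: power_mono)
    qed
  qed
  also have "\<dots> = prob E + (1 - x) ^ n"
    by (subst Bochner_Integration.integral_add) (simp_all add: prob_space emeasure_eq_measure)
  also have "\<dots> \<le> Suc (12 * k) * \<delta> + (Suc k)\<^sup>2 * \<delta>" by (intro add_mono prob_E x_le)
  finally show ?thesis by (simp add: v_def Q_def \<delta>_def algebra_simps)
qed

section \<open>Trigonometric polynomials on the torus and on lines\<close>

definition unit_cube :: "nat \<Rightarrow> (nat \<Rightarrow> real) measure" where
  "unit_cube d = restrict_space (\<Pi>\<^sub>M i\<in>{..<d}. lborel) (\<Pi>\<^sub>E i\<in>{..<d}. {0..<1})"

lemma sets_PiM_unit_cube [measurable]: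
  fixes d :: nat
  shows "(\<Pi>\<^sub>E i\<in>{..<d}. {0..<1::real}) \<in> sets (\<Pi>\<^sub>M i\<in>{..<d}. lborel)"
  by (intro sets_PiM_I_finite) auto

interpretation lborel_product: product_sigma_finite "\<lambda>_::nat. lborel :: real measure"
  by standard

lemma prob_space_unit_cube: "prob_space (unit_cube d)"
  unfolding unit_cube_def
proof (rule prob_space_restrict_space)
  show "emeasure (\<Pi>\<^sub>M i\<in>{..<d}. lborel) (\<Pi>\<^sub>E i\<in>{..<d}. {0..<1::real}) = 1"
    by (subst lborel_product.emeasure_PiM) auto
qed measurable

lemma integral_unit_cube:
  fixes f :: "(nat \<Rightarrow> real) \<Rightarrow> 'b::{banach, second_countable_topology}"
  shows "integral\<^sup>L (unit_cube d) f
    = integral\<^sup>L (\<Pi>\<^sub>M i\<in>{..<d}. lborel) (\<lambda>x. indicator (\<Pi>\<^sub>E i\<in>{..<d}. {0..<1}) x *\<^sub>R f x)"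
  unfolding unit_cube_def by (rule integral_restrict_space) (simp add: space_PiM sets.Int_space_eq2)

lemma measurable_unit_cube_component [measurable]:
  "i < d \<Longrightarrow> (\<lambda>x. x i) \<in> borel_measurable (unit_cube d)"
  unfolding unit_cube_def
  by (intro measurable_restrict_space1) (metis lessThan_iff measurable_component_singleton measurable_lborel1 sets_lborel measurable_cong_sets)

lemma integral_unit_circle_cis:
  fixes n :: int
  shows "integral\<^sup>L unit_circle (\<lambda>t. cis (2 * pi * (n * t))) = (if n = 0 then 1 else 0)"
proof (cases "n = 0")
  case True
  interpret prob_space unit_circle by (rule prob_space_unit_circle)
  show ?thesis using True by (simp add: prob_space)
next
  case False
  have "integral\<^sup>L unit_circle (\<lambda>t. cis (2 * pi * (n * t)))
      = (\<integral>t. indicator {0..<1} t *\<^sub>R cis (2 * pi * (n * t)) \<partial>lborel)"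
    unfolding unit_circle_def by (rule integral_restrict_space) auto
  also have "\<dots> = (\<integral>t. indicator {0..1} t *\<^sub>R cis (2 * pi * (n * t)) \<partial>lborel)"
  proof (rule integral_cong_AE)
    show "AE t in lborel. indicator {0..<1} t *\<^sub>R cis (2 * pi * (n * t)) = indicator {0..1} t *\<^sub>R cis (2 * pi * (n * t))"
      using AE_lborel_singleton[of 1] by eventually_elim (auto simp: indicator_def)
    have "(\<lambda>t::real. cis (2 * pi * (n * t))) \<in> borel_measurable borel"
      by (intro borel_measurable_continuous_onI continuous_intros)
    then show "(\<lambda>t. indicator {0..<1} t *\<^sub>R cis (2 * pi * (n * t))) \<in> borel_measurable lborel"
      "(\<lambda>t. indicator {0..1} t *\<^sub>R cis (2 * pi * (n * t))) \<in> borel_measurable lborel" by auto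
  qed
  also have "\<dots> = cis (2 * pi * (real_of_int n * 1)) * (1 / (2 * pi * n * \<i>)) - cis (2 * pi * (real_of_int n * 0)) * (1 / (2 * pi * n * \<i>))"
  proof (rule integral_FTC_Icc[where F = "\<lambda>t. cis (2 * pi * (real_of_int n * t)) * (1 / (2 * pi * n * \<i>))"])
    fix t :: real
    have "((\<lambda>t. cis (2 * pi * (n * t))) has_vector_derivative (2 * pi * n * \<i>) * cis (2 * pi * (n * t))) (at t within {0..1})"
      by (auto intro!: derivative_eq_intros simp: has_vector_derivative_complex_iff)
    from has_vector_derivative_mult_left[OF this, of "1 / (2 * pi * n * \<i>)"] False
    show "((\<lambda>t. cis (2 * pi * (n * t)) * (1 / (2 * pi * n * \<i>))) has_vector_derivative cis (2 * pi * (n * t))) (at t within {0..1})"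
      by simp
  qed (auto intro!: continuous_intros)
  also have "\<dots> = 0" by simp
  finally show ?thesis using False by simp
qed

lemma integrable_unit_circle_cis: "integrable unit_circle (\<lambda>t. c * cis (a * t))"
proof -
  interpret prob_space unit_circle by (rule prob_space_unit_circle)
  have "(\<lambda>t::real. c * cis (a * t)) \<in> borel_measurable borel"
    by (intro borel_measurable_continuous_onI continuous_intros)
  then show ?thesis
    by (intro integrable_const_bound[where B = "cmod c"])
      (auto simp: norm_mult unit_circle_def intro!: measurable_restrict_space1)
qed

lemma cis_sum: "finite I \<Longrightarrow> cis (sum f I) = (\<Prod>i\<in>I. cis (f i))"
  by (induction I rule: finite_induct) (auto simp: cis_mult[symmetric])

text \<open>The exponential and the indicator of the cube are products of functions of one
  coordinate, so Fubini reduces the claim to the circle.\<close>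

lemma integral_unit_cube_cis:
  fixes v :: "nat \<Rightarrow> int"
  shows "integral\<^sup>L (unit_cube d) (\<lambda>x. cis (2 * pi * (\<Sum>i<d. v i * x i))) = (if \<forall>i<d. v i = 0 then 1 else 0)"
proof -
  let ?f = "\<lambda>i (t::real). indicator {0..<1} t *\<^sub>R cis (2 * pi * (v i * t))"
  have int: "integral\<^sup>L lborel (?f i) = (if v i = 0 then 1 else 0)" for i
    unfolding integral_unit_circle_cis[symmetric] unit_circle_def
    by (rule integral_restrict_space[symmetric]) auto
  have intble: "integrable lborel (?f i)" for i
    using integrable_unit_circle_cis[of 1 "2 * pi * v i"] unfolding unit_circle_def
    by (subst (asm) integrable_restrict_space) (auto simp: mult.assoc)
  have "integral\<^sup>L (unit_cube d) (\<lambda>x. cis (2 * pi * (\<Sum>i<d. v i * x i)))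
      = integral\<^sup>L (\<Pi>\<^sub>M i\<in>{..<d}. lborel) (\<lambda>x. \<Prod>i<d. ?f i (x i))"
    unfolding integral_unit_cube
  proof (rule Bochner_Integration.integral_cong[OF refl])
    fix x assume x: "x \<in> space (\<Pi>\<^sub>M i\<in>{..<d}. lborel :: real measure)"
    show "indicator (\<Pi>\<^sub>E i\<in>{..<d}. {0..<1}) x *\<^sub>R cis (2 * pi * (\<Sum>i<d. v i * x i)) = (\<Prod>i<d. ?f i (x i))"
    proof (cases "x \<in> (\<Pi>\<^sub>E i\<in>{..<d}. {0..<1})")
      case True
      then have "?f i (x i) = cis (2 * pi * (v i * x i))" if "i < d" for i
        using that PiE_mem[OF True, of i] by simp
      with True show ?thesis by (simp add: cis_sum sum_distrib_left)
    next
      case False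
      with x obtain i where "i < d" "x i \<notin> {0..<1}" by (auto simp: space_PiM PiE_iff)
      with False show ?thesis by (auto intro!: prod_zero[symmetric] bexI[of _ i])
    qed
  qed
  also have "\<dots> = (\<Prod>i<d. integral\<^sup>L lborel (?f i))"
    by (rule lborel_product.product_integral_prod) (auto intro: intble)
  also have "\<dots> = (if \<forall>i<d. v i = 0 then 1 else 0)"
    unfolding int by (auto intro!: prod.neutral)
  finally show ?thesis .
qed

text \<open>Generating the class from exponentials by sums reduces linear statements to a single
  exponential, without fixing a set of frequencies. The index \<open>n\<close> bounds the maximum
  norm of the frequencies.\<close>

inductive trig_poly :: "nat \<Rightarrow> nat \<Rightarrow> ((nat \<Rightarrow> real) \<Rightarrow> complex) \<Rightarrow> bool" for d n where
  monomial: "(\<And>i. i < d \<Longrightarrow> \<bar>v i\<bar> \<le> int n) \<Longrightarrow> trig_poly d n (\<lambda>x. c * cis (2 * pi * (\<Sum>i<d. v i * x i)))"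
| add: "trig_poly d n F \<Longrightarrow> trig_poly d n G \<Longrightarrow> trig_poly d n (\<lambda>x. F x + G x)"

lemma trig_poly_const: "trig_poly d n (\<lambda>x. c)"
  using trig_poly.monomial[of d "\<lambda>_. 0" n c] by simp

lemma trig_poly_sum: "(\<And>i. i \<in> I \<Longrightarrow> trig_poly d n (F i)) \<Longrightarrow> trig_poly d n (\<lambda>x. \<Sum>i\<in>I. F i x)"
  by (induction I rule: infinite_finite_induct) (auto intro: trig_poly_const trig_poly.add)

lemma trig_poly_mult:
  assumes "trig_poly d n F" "trig_poly d m G"
  shows "trig_poly d (n + m) (\<lambda>x. F x * G x)"
  using assms(1)
proof induction
  case (monomial v c)
  note v = monomial
  from assms(2) show ?case
  proof induction
    case (monomial w e)
    have "trig_poly d (n + m) (\<lambda>x. c * e * cis (2 * pi * (\<Sum>i<d. (v i + w i) * x i)))"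
      using v monomial by (intro trig_poly.monomial) (smt (verit) of_nat_add)
    then show ?case
      by (simp add: algebra_simps sum.distrib flip: cis_mult)
  next
    case (add F G)
    then show ?case by (simp add: distrib_left trig_poly.add)
  qed
next
  case (add F G)
  then show ?case by (simp add: distrib_right trig_poly.add)
qed

lemma trig_poly_power: "trig_poly d n F \<Longrightarrow> trig_poly d (j * n) (\<lambda>x. F x ^ j)"
  by (induction j) (auto intro: trig_poly_const trig_poly_mult)

text \<open>For an exponential of frequency v the integral over the cube vanishes unless v = 0, the
  integral over the line unless the pairing of a and v is 0. By \<open>indep\<close> these
  conditions agree.\<close>

lemma integral_trig_poly_eq:
  fixes a :: "nat \<Rightarrow> int"
  assumes F: "trig_poly d n F"
    and indep: "\<And>v. (\<And>i. i < d \<Longrightarrow> \<bar>v i\<bar> \<le> int n) \<Longrightarrow> (\<Sum>i<d. a i * v i) = 0 \<Longrightarrow> \<forall>i<d. v i = 0"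
  shows "integral\<^sup>L (unit_cube d) F = integral\<^sup>L unit_circle (\<lambda>t. F (\<lambda>i. a i * t))"
proof -
  interpret prob_space "unit_cube d" by (rule prob_space_unit_cube)
  \<comment> \<open>Integrability is carried through the induction because additivity of the
    integral requires it.\<close>
  have "integrable (unit_cube d) F \<and> integrable unit_circle (\<lambda>t. F (\<lambda>i. a i * t)) \<and> ?thesis"
    using F
  proof induction
    case (monomial v c)
    have eq: "(\<Sum>i<d. v i * (a i * t)) = (\<Sum>i<d. a i * v i) * t" for t :: real
      unfolding of_int_sum sum_distrib_right by (intro sum.cong) (simp_all add: mult_ac)
    have "(\<lambda>x. \<Sum>i<d. v i * x i) \<in> borel_measurable (unit_cube d)"
      by (intro borel_measurable_sum borel_measurable_times borel_measurable_const measurable_unit_cube_component) auto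
    moreover have "(\<lambda>s. c * cis (2 * pi * s)) \<in> borel_measurable borel"
      by (intro borel_measurable_continuous_onI continuous_intros)
    ultimately have "(\<lambda>x. c * cis (2 * pi * (\<Sum>i<d. v i * x i))) \<in> borel_measurable (unit_cube d)"
      by (rule measurable_compose)
    then have "integrable (unit_cube d) (\<lambda>x. c * cis (2 * pi * (\<Sum>i<d. v i * x i)))"
      by (intro integrable_const_bound[where B = "cmod c"]) (auto simp: norm_mult)
    moreover have "integrable unit_circle (\<lambda>t. c * cis (2 * pi * (\<Sum>i<d. v i * (a i * t))))"
      unfolding eq using integrable_unit_circle_cis[of c "2 * pi * (\<Sum>i<d. a i * v i)"] by (simp add: mult.assoc)
    moreover have "(\<forall>i<d. v i = 0) \<longleftrightarrow> (\<Sum>i<d. a i * v i) = 0"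
      using indep[of v] monomial by auto
    then have "integral\<^sup>L (unit_cube d) (\<lambda>x. c * cis (2 * pi * (\<Sum>i<d. v i * x i)))
      = integral\<^sup>L unit_circle (\<lambda>t. c * cis (2 * pi * (\<Sum>i<d. v i * (a i * t))))"
      unfolding eq integral_mult_right_zero integral_unit_cube_cis integral_unit_circle_cis by simp
    ultimately show ?case by blast
  qed simp
  then show ?thesis by blast
qed

section \<open>Mahler measures as torus integrals\<close>

lemma laurent_eval_add: "laurent_eval (R + S) z = laurent_eval R z + laurent_eval S z"
  unfolding laurent_eval_def
  by (rule setsum_keys_plus_distrib[where f = "\<lambda>u c. c * (\<Prod>i\<in>Poly_Mapping.keys u. z i powi Poly_Mapping.lookup u i)"])
    (simp_all add: distrib_right)

lemma laurent_eval_sum: "laurent_eval (sum f A) z = (\<Sum>i\<in>A. laurent_eval (f i) z)"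
  by (induction A rule: infinite_finite_induct) (simp_all add: laurent_eval_add, simp_all add: laurent_eval_def)

lemma laurent_eval_single:
  "laurent_eval (Poly_Mapping.single u c) z = c * (\<Prod>i\<in>Poly_Mapping.keys u. z i powi Poly_Mapping.lookup u i)"
  by (simp add: laurent_eval_def)

text \<open>Monomials on the torus are exponentials of 2 pi i times this pairing. Being additive in
  \<open>u\<close>, it turns products of substituted variables into sums.\<close>

definition exponent_pairing :: "(nat \<Rightarrow>\<^sub>0 int) \<Rightarrow> (nat \<Rightarrow> real) \<Rightarrow> real" where
  "exponent_pairing u x = (\<Sum>i\<in>Poly_Mapping.keys u. real_of_int (Poly_Mapping.lookup u i) * x i)"

lemma exponent_pairing_add: "exponent_pairing (u + v) x = exponent_pairing u x + exponent_pairing v x"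
  unfolding exponent_pairing_def
  by (rule setsum_keys_plus_distrib[where f = "\<lambda>i n. real_of_int n * x i"]) (simp_all add: distrib_right)

lemma exponent_pairing_sum: "exponent_pairing (sum f A) x = (\<Sum>i\<in>A. exponent_pairing (f i) x)"
  by (induction A rule: infinite_finite_induct) (simp_all add: exponent_pairing_add, simp_all add: exponent_pairing_def)

lemma exponent_pairing_single: "exponent_pairing (Poly_Mapping.single i n) x = n * x i"
  by (simp add: exponent_pairing_def)

lemma prod_cis_powi_eq_cis_exponent_pairing:
  "(\<Prod>i\<in>Poly_Mapping.keys u. cis (2 * pi * x i) powi Poly_Mapping.lookup u i) = cis (2 * pi * exponent_pairing u x)"
  by (simp add: cis_power_int exponent_pairing_def cis_sum sum_distrib_left mult_ac)

lemma X_pow_power: "X_pow j e ^ n = Poly_Mapping.single (Poly_Mapping.single j (int n * e)) 1"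
  by (induction n) (simp_all add: X_pow_def mult_single distrib_right single_add)

lemma prod_single_one:
  "(\<Prod>i\<in>A. Poly_Mapping.single (f i) 1) = Poly_Mapping.single (\<Sum>i\<in>A. f i) (1 :: 'a :: comm_semiring_1)"
  by (induction A rule: infinite_finite_induct) (simp_all add: mult_single)

text \<open>The argument ranges over all real vectors, so that a line y i = a i t is followed
  without reduction modulo 1.\<close>

definition torus_eval :: "nat \<Rightarrow> mpoly \<Rightarrow> (nat \<Rightarrow> real) \<Rightarrow> complex" where
  "torus_eval d P y = (\<Sum>m\<in>Poly_Mapping.keys P. Poly_Mapping.lookup P m *
     cis (2 * pi * (\<Sum>i<d. real_of_int (int (Poly_Mapping.lookup m i)) * y i)))"

text \<open>One computation serves both Laurent polynomials: \<open>g\<close> the identity and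
  \<open>e\<close> = 1 give \<open>P\<close> itself, \<open>g\<close> = 0 and \<open>e\<close> =
  \<open>a\<close> give the substitution of powers.\<close>

lemma laurent_eval_mpoly_subst:
  assumes "P \<in> mpolys K d"
  shows "laurent_eval (mpoly_subst (\<lambda>i. X_pow (g i) (e i)) P) (\<lambda>i. exp (2 * of_real pi * \<i> * of_real (x i)))
    = torus_eval d P (\<lambda>i. e i * x (g i))"
proof -
  have exp: "exp (2 * of_real pi * \<i> * of_real (x i)) = cis (2 * pi * x i)" for i
    by (simp add: cis_conv_exp mult_ac)
  have "(\<Sum>i\<in>Poly_Mapping.keys m. int (Poly_Mapping.lookup m i) * e i * x (g i))
      = (\<Sum>i<d. int (Poly_Mapping.lookup m i) * (e i * x (g i)))" if "m \<in> Poly_Mapping.keys P" for m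
    using assms that by (intro sum.mono_neutral_cong_left) (auto simp: mpolys_def in_keys_iff)
  then show ?thesis
    unfolding mpoly_subst_def laurent_eval_sum torus_eval_def exp
    by (intro sum.cong) (simp_all add: X_pow_power prod_single_one mult_single laurent_eval_single
      prod_cis_powi_eq_cis_exponent_pairing exponent_pairing_sum exponent_pairing_single)
qed

lemma mahler_laurent_of:
  assumes "P \<in> mpolys K d"
  shows "mahler d (laurent_of P) = integral\<^sup>L (unit_cube d) (\<lambda>x. ln (cmod (torus_eval d P x)))"
  using laurent_eval_mpoly_subst[OF assms, of "\<lambda>i. i" "\<lambda>_. 1"]
  by (simp add: mahler_def set_lebesgue_integral_def integral_unit_cube laurent_of_def)

lemma integral_unit_cube_1:
  fixes f :: "real \<Rightarrow> real"
  assumes "f \<in> borel_measurable borel"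
  shows "integral\<^sup>L (unit_cube 1) (\<lambda>x. f (x 0)) = integral\<^sup>L unit_circle f"
proof -
  have one: "{..<1} = {0::nat}" by auto
  have "integral\<^sup>L (unit_cube 1) (\<lambda>x. f (x 0)) = (\<integral>x. indicator {0..<1} (x 0) *\<^sub>R f (x 0) \<partial>(\<Pi>\<^sub>M i\<in>{0::nat}. lborel))"
    unfolding integral_unit_cube one
  proof (rule Bochner_Integration.integral_cong[OF refl])
    fix x assume "x \<in> space (\<Pi>\<^sub>M i\<in>{0::nat}. lborel :: real measure)"
    then have "x \<in> (\<Pi>\<^sub>E i\<in>{0}. {0..<1}) \<longleftrightarrow> x 0 \<in> {0..<1}"
      by (simp add: space_PiM PiE_iff)
    then show "indicator (\<Pi>\<^sub>E i\<in>{0}. {0..<1}) x *\<^sub>R f (x 0) = indicator {0..<1} (x 0) *\<^sub>R f (x 0)"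
      by (simp add: indicator_def)
  qed
  also have "\<dots> = (\<integral>t. indicator {0..<1} t *\<^sub>R f t \<partial>lborel)"
    using assms by (intro lborel_product.product_integral_singleton[where f = "\<lambda>t. indicator {0..<1} t *\<^sub>R f t"]) auto
  also have "\<dots> = integral\<^sup>L unit_circle f"
    unfolding unit_circle_def by (rule integral_restrict_space[symmetric]) auto
  finally show ?thesis .
qed

lemma mahler_subst_powers:
  assumes "P \<in> mpolys K d"
  shows "mahler 1 (subst_powers a P) = integral\<^sup>L unit_circle (\<lambda>t. ln (cmod (torus_eval d P (\<lambda>i. a i * t))))"
proof -
  have "continuous_on UNIV (\<lambda>t. torus_eval d P (\<lambda>i. real_of_int (a i) * t))"
    unfolding torus_eval_def by (intro continuous_intros)
  then have [measurable]: "(\<lambda>t. torus_eval d P (\<lambda>i. real_of_int (a i) * t)) \<in> borel_measurable borel"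
    by (rule borel_measurable_continuous_onI)
  have meas: "(\<lambda>t. ln (cmod (torus_eval d P (\<lambda>i. real_of_int (a i) * t)))) \<in> borel_measurable borel"
    by measurable
  have "mahler 1 (subst_powers a P) = integral\<^sup>L (unit_cube 1) (\<lambda>x. ln (cmod (torus_eval d P (\<lambda>i. a i * x 0))))"
    using laurent_eval_mpoly_subst[OF assms, of "\<lambda>_. 0" a]
    by (simp add: mahler_def set_lebesgue_integral_def integral_unit_cube subst_powers_def)
  then show ?thesis
    using integral_unit_cube_1[OF meas] by (rule trans)
qed

section \<open>Directions without small integer relations\<close>

definition no_relation :: "nat \<Rightarrow> nat \<Rightarrow> (nat \<Rightarrow> int) \<Rightarrow> bool" where
  "no_relation d n a \<longleftrightarrow>
    (\<forall>v. (\<forall>i<d. \<bar>v i\<bar> \<le> int n) \<longrightarrow> (\<Sum>i<d. a i * v i) = 0 \<longrightarrow> (\<forall>i<d. v i = 0))"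

lemma no_relation_mono: "no_relation d n a \<Longrightarrow> m \<le> n \<Longrightarrow> no_relation d m a"
  unfolding no_relation_def
proof (intro allI impI)
  fix v i
  assume "\<forall>v. (\<forall>i<d. \<bar>v i\<bar> \<le> int n) \<longrightarrow> (\<Sum>i<d. a i * v i) = 0 \<longrightarrow> (\<forall>i<d. v i = 0)"
    and "m \<le> n" "\<forall>i<d. \<bar>v i\<bar> \<le> int m" "(\<Sum>i<d. a i * v i) = 0" "i < d"
  moreover from this have "\<forall>i<d. \<bar>v i\<bar> \<le> int n" by force
  ultimately show "v i = 0" by simp
qed

text \<open>A relation is an expansion of 0 in base n + 1 with digits of modulus at most n. The
  lowest digit is divisible by n + 1, hence 0, and dividing by n + 1 leaves a relation of length one
  less.\<close>

lemma no_relation_powers: "no_relation d n (\<lambda>i. (int n + 1) ^ i)"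
proof (induction d)
  case 0
  then show ?case by (simp add: no_relation_def)
next
  case (Suc d)
  show ?case unfolding no_relation_def
  proof (rule allI, intro impI)
    fix v :: "nat \<Rightarrow> int"
    assume v: "\<forall>i<Suc d. \<bar>v i\<bar> \<le> int n" and eq: "(\<Sum>i<Suc d. (int n + 1) ^ i * v i) = 0"
    have split: "v 0 + (int n + 1) * (\<Sum>i<d. (int n + 1) ^ i * v (Suc i)) = 0"
      using eq by (simp add: sum.lessThan_Suc_shift sum_distrib_left mult.assoc del: sum.lessThan_Suc)
    then have "(int n + 1) dvd v 0"
      by (metis dvd_0_right dvd_add_left_iff dvd_triv_left)
    then have "v 0 = 0"
      using v dvd_imp_le_int[of "v 0" "int n + 1"] by force
    with split have "(\<Sum>i<d. (int n + 1) ^ i * v (Suc i)) = 0" by simp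
    moreover have "\<forall>i<d. \<bar>v (Suc i)\<bar> \<le> int n" using v by simp
    ultimately have "\<forall>i<d. v (Suc i) = 0"
      using Suc[unfolded no_relation_def, THEN spec[of _ "\<lambda>i. v (Suc i)"]] by blast
    with \<open>v 0 = 0\<close> show "\<forall>i<Suc d. v i = 0" by (auto simp: less_Suc_eq_0_disj)
  qed
qed

text \<open>The analytic argument sees \<open>rho\<close> only through this lemma: a nonzero
  relation of norm at most \<open>n\<close> would be a competitor in the infimum.\<close>

lemma no_relation_if_less_rho:
  assumes "enat n < rho d a"
  shows "no_relation d n a"
  unfolding no_relation_def
proof (intro allI impI, rule ccontr)
  fix v i assume v: "\<forall>i<d. \<bar>v i\<bar> \<le> int n" "(\<Sum>i<d. a i * v i) = 0" and "i < d" "v i \<noteq> 0"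
  then have "nonzero_vec d v" by (auto simp: nonzero_vec_def)
  then have "rho d a \<le> enat (max_norm d v)"
    unfolding rho_def using v by (intro INF_lower) simp
  also have "max_norm d v \<le> n"
    unfolding max_norm_def using v \<open>i < d\<close> by (subst Max_le_iff) auto
  finally show False using assms by (simp add: leD)
qed

lemma lookup_le_total_degree:
  assumes "m \<in> Poly_Mapping.keys P"
  shows "Poly_Mapping.lookup m i \<le> total_degree P"
proof -
  have "Poly_Mapping.lookup m i \<le> (\<Sum>i\<in>Poly_Mapping.keys m. Poly_Mapping.lookup m i)"
    by (cases "i \<in> Poly_Mapping.keys m") (auto simp: in_keys_iff intro: member_le_sum)
  also have "\<dots> \<le> total_degree P"
    unfolding total_degree_def using assms by (intro Max_ge) auto
  finally show ?thesis .
qed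

text \<open>Two exponents with the same image differ by a relation, whose entries are bounded by the
  degree because those of both exponents lie between 0 and the degree. Thus no two terms of
  \<open>P\<close> merge on the line, and Lawton's estimate applies with the coefficients of
  \<open>P\<close>.\<close>

lemma no_relation_imp_inj_on_monomials:
  assumes P: "P \<in> mpolys K d" and a: "no_relation d (total_degree P) a"
  shows "inj_on (\<lambda>m. \<Sum>i<d. a i * int (Poly_Mapping.lookup m i)) (Poly_Mapping.keys P)"
proof (rule inj_onI)
  fix m m' assume m: "m \<in> Poly_Mapping.keys P" "m' \<in> Poly_Mapping.keys P"
    and eq: "(\<Sum>i<d. a i * int (Poly_Mapping.lookup m i)) = (\<Sum>i<d. a i * int (Poly_Mapping.lookup m' i))"
  define v where "v i = int (Poly_Mapping.lookup m i) - int (Poly_Mapping.lookup m' i)" for i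
  have "\<bar>v i\<bar> \<le> int (total_degree P)" for i
    using lookup_le_total_degree[OF m(1), of i] lookup_le_total_degree[OF m(2), of i] by (simp add: v_def)
  moreover have "(\<Sum>i<d. a i * v i) = 0"
    using eq by (simp add: v_def right_diff_distrib sum_subtractf)
  ultimately have v0: "v i = 0" if "i < d" for i
    using a that unfolding no_relation_def by blast
  show "m = m'"
  proof (rule poly_mapping_eqI)
    fix i
    show "Poly_Mapping.lookup m i = Poly_Mapping.lookup m' i"
    proof (cases "i < d")
      case True
      with v0[OF this] show ?thesis by (simp add: v_def)
    next
      case False
      then have "i \<notin> Poly_Mapping.keys m" "i \<notin> Poly_Mapping.keys m'"
        using P m by (auto simp: mpolys_def)
      then show ?thesis by (simp add: in_keys_iff)
    qed
  qed
qed

section \<open>Comparison of the torus with a line\<close>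

lemma torus_eval_line:
  "torus_eval d P (\<lambda>i. a i * t) = (\<Sum>m\<in>Poly_Mapping.keys P. Poly_Mapping.lookup P m *
     cis (2 * pi * ((\<Sum>i<d. a i * int (Poly_Mapping.lookup m i)) * t)))"
proof -
  have "(\<Sum>i<d. int (Poly_Mapping.lookup m i) * (a i * t)) = (\<Sum>i<d. a i * int (Poly_Mapping.lookup m i)) * t" for m
    unfolding of_int_sum sum_distrib_right by (intro sum.cong) (simp_all add: mult_ac)
  then show ?thesis unfolding torus_eval_def by simp
qed

lemma cis_diff: "cis (c * (a - b)) = cis (c * a) * cnj (cis (c * b))"
  by (simp add: cis_cnj cis_mult right_diff_distrib)

text \<open>Expanding |P|^2 as P times its conjugate gives the frequencies m - m'. Their entries are
  differences of numbers between 0 and the degree, so the bound is the degree and not twice the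
  degree.\<close>

lemma trig_poly_one_minus_norm_squared_torus_eval:
  "trig_poly d (total_degree P) (\<lambda>y. complex_of_real (1 - (cmod (torus_eval d P y) / B)\<^sup>2))"
proof -
  let ?T = "\<lambda>m m' (y :: nat \<Rightarrow> real). (- 1 / of_real (B\<^sup>2)) * (Poly_Mapping.lookup P m * cnj (Poly_Mapping.lookup P m')) *
      cis (2 * pi * (\<Sum>i<d. real_of_int (int (Poly_Mapping.lookup m i) - int (Poly_Mapping.lookup m' i)) * y i))"
  have T: "trig_poly d (total_degree P) (?T m m')" if "m \<in> Poly_Mapping.keys P" "m' \<in> Poly_Mapping.keys P" for m m'
  proof (rule trig_poly.monomial)
    show "\<bar>int (Poly_Mapping.lookup m i) - int (Poly_Mapping.lookup m' i)\<bar> \<le> int (total_degree P)" for i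
      using lookup_le_total_degree[of m P i] lookup_le_total_degree[of m' P i] that by simp
  qed
  have eq: "complex_of_real (1 - (cmod (torus_eval d P y) / B)\<^sup>2)
      = 1 + (\<Sum>m\<in>Poly_Mapping.keys P. \<Sum>m'\<in>Poly_Mapping.keys P. ?T m m' y)" for y
  proof -
    let ?s = "\<lambda>m. \<Sum>i<d. real_of_int (int (Poly_Mapping.lookup m i)) * y i"
    have diff: "(\<Sum>i<d. real_of_int (int (Poly_Mapping.lookup m i) - int (Poly_Mapping.lookup m' i)) * y i) = ?s m - ?s m'" for m m'
      by (simp add: left_diff_distrib sum_subtractf)
    define E where "E m = cis (2 * pi * ?s m)" for m
    have T_eq: "?T m m' y = (- 1 / of_real (B\<^sup>2)) *
        ((Poly_Mapping.lookup P m * E m) * (cnj (Poly_Mapping.lookup P m') * cnj (E m')))" for m m'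
      unfolding diff cis_diff E_def by (simp only: mult_ac)
    have "torus_eval d P y * cnj (torus_eval d P y) = (\<Sum>m\<in>Poly_Mapping.keys P. \<Sum>m'\<in>Poly_Mapping.keys P.
        (Poly_Mapping.lookup P m * E m) * (cnj (Poly_Mapping.lookup P m') * cnj (E m')))"
      by (simp only: torus_eval_def E_def cnj_sum complex_cnj_mult sum_product)
    then have "(\<Sum>m\<in>Poly_Mapping.keys P. \<Sum>m'\<in>Poly_Mapping.keys P. ?T m m' y)
        = (- 1 / of_real (B\<^sup>2)) * (torus_eval d P y * cnj (torus_eval d P y))"
      unfolding T_eq by (simp only: sum_distrib_left)
    also have "\<dots> = - of_real ((cmod (torus_eval d P y) / B)\<^sup>2)"
      by (simp add: power_divide flip: complex_norm_square)
    finally show ?thesis by simp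
  qed
  have "trig_poly d (total_degree P) (\<lambda>y. 1 + (\<Sum>m\<in>Poly_Mapping.keys P. \<Sum>m'\<in>Poly_Mapping.keys P. ?T m m' y))"
    by (intro trig_poly.add trig_poly_const trig_poly_sum T)
  then show ?thesis unfolding eq .
qed

lemma moments_eq_on_line:
  assumes "no_relation d (j * total_degree P) a"
  shows "integral\<^sup>L (unit_cube d) (\<lambda>x. (1 - (cmod (torus_eval d P x) / B)\<^sup>2) ^ j)
    = integral\<^sup>L unit_circle (\<lambda>t. (1 - (cmod (torus_eval d P (\<lambda>i. a i * t)) / B)\<^sup>2) ^ j)"
proof -
  have "integral\<^sup>L (unit_cube d) (\<lambda>x. complex_of_real (1 - (cmod (torus_eval d P x) / B)\<^sup>2) ^ j)
      = integral\<^sup>L unit_circle (\<lambda>t. complex_of_real (1 - (cmod (torus_eval d P (\<lambda>i. a i * t)) / B)\<^sup>2) ^ j)"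
    using assms unfolding no_relation_def
    by (intro integral_trig_poly_eq[OF trig_poly_power[OF trig_poly_one_minus_norm_squared_torus_eval]]) blast
  then show ?thesis
    unfolding of_real_power[symmetric] integral_complex_of_real of_real_eq_iff .
qed

lemma norm_torus_eval_le:
  assumes "card (Poly_Mapping.keys P) \<le> n"
    and "\<And>m. m \<in> Poly_Mapping.keys P \<Longrightarrow> cmod (Poly_Mapping.lookup P m) \<le> L" and "0 \<le> L"
  shows "cmod (torus_eval d P x) \<le> n * L"
proof -
  have "cmod (torus_eval d P x) \<le> (\<Sum>m\<in>Poly_Mapping.keys P. L)"
    unfolding torus_eval_def using assms(2) by (intro sum_norm_le) (simp add: norm_mult)
  also have "\<dots> \<le> n * L" using assms(1,3) by (simp add: mult_right_mono)
  finally show ?thesis .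
qed

text \<open>Both measures are compared with the same truncated series: the moments for j up to n
  agree on the torus and on the line, and \<open>expectation_ln_partial_sum\<close> bounds both
  remainders alike. The value of \<open>s\<close> is half the decay exponent 1/(4k) of the
  moments.\<close>

lemma abs_mahler_diff_le:
  assumes P: "P \<in> mpolys K d" "P \<noteq> 0" "card (Poly_Mapping.keys P) \<le> Suc k" and "1 \<le> k"
    and a: "no_relation d (total_degree P) a" "no_relation d (n * total_degree P) a"
  defines "s \<equiv> 1 / (8 * real k)"
  shows "\<bar>mahler 1 (subst_powers a P) - mahler d (laurent_of P)\<bar>
    \<le> 2 * (Suc (12 * k) + (Suc k)\<^sup>2) * suminf (\<lambda>j. real (Suc j) powr (- 1 - s)) * real (Suc n) powr (- s)"
proof -
  let ?c = "\<lambda>m. cmod (Poly_Mapping.lookup P m)"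
  define L where "L = Max (?c ` Poly_Mapping.keys P)"
  have "Poly_Mapping.keys P \<noteq> {}" using P(2) by simp
  then have "L \<in> ?c ` Poly_Mapping.keys P" unfolding L_def by (intro Max_in) auto
  then obtain m0 where m0: "m0 \<in> Poly_Mapping.keys P" "?c m0 = L" by blast
  then have "0 < L" by (auto simp: in_keys_iff)
  have L: "?c m \<le> L" if "m \<in> Poly_Mapping.keys P" for m
    unfolding L_def using that by (intro Max_ge) auto
  define B where "B = Suc k * L"
  have "0 < B" using \<open>0 < L\<close> by (simp add: B_def)
  have le_B: "cmod (torus_eval d P x) \<le> B" for x
    unfolding B_def using P(3) L \<open>0 < L\<close> by (intro norm_torus_eval_le) auto
  have "0 < s" using \<open>1 \<le> k\<close> by (simp add: s_def)
  have s2: "- 2 * s = - (1 / (4 * k))" using \<open>1 \<le> k\<close> by (simp add: s_def field_simps)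
  let ?A = "real (Suc (12 * k) + (Suc k)\<^sup>2)"
  have circle: "integral\<^sup>L unit_circle (\<lambda>t. (1 - (cmod (torus_eval d P (\<lambda>i. b i * t)) / B)\<^sup>2) ^ j) \<le> ?A * real j powr (- 2 * s)"
    if "no_relation d (total_degree P) b" "1 \<le> j" for b :: "nat \<Rightarrow> int" and j
    unfolding B_def torus_eval_line s2
    using integral_trig_moment_le[where c = "Poly_Mapping.lookup P" and j = m0, OF finite_keys P(3) no_relation_imp_inj_on_monomials[OF P(1) that(1)] m0 L \<open>0 < L\<close> \<open>1 \<le> k\<close> that(2)]
    by simp
  have cube: "integral\<^sup>L (unit_cube d) (\<lambda>x. (1 - (cmod (torus_eval d P x) / B)\<^sup>2) ^ j) \<le> ?A * real j powr (- 2 * s)"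
    if "1 \<le> j" for j
  proof -
    \<comment> \<open>The direction may vary with \<open>j\<close>, since the bound in
      \<open>circle\<close> is the same for all directions that separate the monomials. Excluding
      relations up to j deg P preserves the j-th moment.\<close>
    define b where "b = (\<lambda>i. (int (j * total_degree P) + 1) ^ i)"
    have b: "no_relation d (j * total_degree P) b"
      unfolding b_def by (rule no_relation_powers)
    have "total_degree P \<le> j * total_degree P" using that by simp
    then have "no_relation d (total_degree P) b" by (rule no_relation_mono[OF b])
    then show ?thesis
      unfolding moments_eq_on_line[OF b] using that by (rule circle)
  qed
  have "continuous_on UNIV (\<lambda>t. torus_eval d P (\<lambda>i. real_of_int (a i) * t))"
    unfolding torus_eval_def by (intro continuous_intros)
  then have "(\<lambda>t. torus_eval d P (\<lambda>i. real_of_int (a i) * t)) \<in> borel_measurable borel"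
    by (rule borel_measurable_continuous_onI)
  then have m1: "(\<lambda>t. cmod (torus_eval d P (\<lambda>i. real_of_int (a i) * t))) \<in> borel_measurable unit_circle"
    unfolding unit_circle_def by (intro measurable_restrict_space1) auto
  have m2: "(\<lambda>x. cmod (torus_eval d P x)) \<in> borel_measurable (unit_cube d)"
  proof -
    have "(\<lambda>s. cis (2 * pi * s)) \<in> borel_measurable borel"
      by (intro borel_measurable_continuous_onI continuous_intros)
    moreover have "(\<lambda>x. \<Sum>i<d. real_of_int (int (Poly_Mapping.lookup m i)) * x i) \<in> borel_measurable (unit_cube d)" for m
      by (intro borel_measurable_sum borel_measurable_times borel_measurable_const measurable_unit_cube_component) auto
    ultimately have [measurable]: "(\<lambda>x. cis (2 * pi * (\<Sum>i<d. real_of_int (int (Poly_Mapping.lookup m i)) * x i)))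
        \<in> borel_measurable (unit_cube d)" for m
      by (rule measurable_compose[rotated])
    show ?thesis unfolding torus_eval_def by measurable
  qed
  let ?S = "\<Sum>j<Suc n. integral\<^sup>L (unit_cube d) (\<lambda>x. (1 - (cmod (torus_eval d P x) / B)\<^sup>2) ^ j) / j"
  let ?R = "?A * suminf (\<lambda>j. real (Suc j) powr (- 1 - s)) * real (Suc n) powr (- s)"
  have "\<bar>mahler d (laurent_of P) - (ln B - ?S / 2)\<bar> \<le> ?R"
    unfolding mahler_laurent_of[OF P(1)]
    using prob_space_unit_cube m2 _ _ \<open>0 < B\<close> \<open>0 < s\<close> cube
    by (rule prob_space.expectation_ln_partial_sum) (auto intro: le_B)
  moreover have "\<bar>mahler 1 (subst_powers a P) - (ln B - ?S / 2)\<bar> \<le> ?R"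
  proof -
    have "integral\<^sup>L (unit_cube d) (\<lambda>x. (1 - (cmod (torus_eval d P x) / B)\<^sup>2) ^ j)
        = integral\<^sup>L unit_circle (\<lambda>t. (1 - (cmod (torus_eval d P (\<lambda>i. a i * t)) / B)\<^sup>2) ^ j)" if "j < Suc n" for j
      using that by (intro moments_eq_on_line no_relation_mono[OF a(2)]) simp
    then have S: "?S = (\<Sum>j<Suc n. integral\<^sup>L unit_circle (\<lambda>t. (1 - (cmod (torus_eval d P (\<lambda>i. a i * t)) / B)\<^sup>2) ^ j) / j)"
      by (intro sum.cong) (simp_all only: lessThan_iff)
    show ?thesis
      unfolding mahler_subst_powers[OF P(1)] S
      using prob_space_unit_circle m1 _ _ \<open>0 < B\<close> \<open>0 < s\<close> circle[OF a(1)]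
      by (rule prob_space.expectation_ln_partial_sum) (auto intro: le_B)
  qed
  ultimately have "\<bar>mahler 1 (subst_powers a P) - mahler d (laurent_of P)\<bar> \<le> 2 * ?R" by linarith
  then show ?thesis by (simp only: mult.assoc of_nat_mult of_nat_numeral)
qed

section \<open>Choice of the truncation\<close>

theorem theoremA1:
  fixes d k :: nat
  assumes "d \<ge> 1" and "k \<ge> 2"
  shows "\<exists>C::real. C > 0 \<and>
    (\<forall>(K::complex set) (P::mpoly) (a::nat \<Rightarrow> int).
      is_subfield K \<longrightarrow> P \<in> mpolys K d \<longrightarrow> P \<noteq> 0 \<longrightarrow> card (Poly_Mapping.keys P) \<le> k \<longrightarrow>
      nonzero_vec d a \<longrightarrow> rho d a > enat (total_degree P) \<longrightarrow>
      (case rho d a of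
         enat r \<Rightarrow> \<bar>mahler 1 (subst_powers a P) - mahler d (laurent_of P)\<bar>
                    \<le> C * (real (total_degree P) ^ (16 * d\<^sup>2) / real r powr (1 / (16 * (real k - 1))))
       | \<infinity> \<Rightarrow> mahler 1 (subst_powers a P) = mahler d (laurent_of P)))"
proof -
  \<comment> \<open>Here \<open>K\<close> is the number k - 1; the field of coefficients is called
    \<open>F\<close> below.\<close>
  obtain K where k: "k = Suc K" and "1 \<le> K"
    using \<open>k \<ge> 2\<close> by (cases k) auto
  define s where "s = 1 / (8 * real K)"
  have s: "0 < s" "1 / (16 * (real k - 1)) \<le> s" "s \<le> 1"
    using \<open>1 \<le> K\<close> by (simp_all add: s_def k field_simps)
  define C where "C = 2 * (Suc (12 * K) + (Suc K)\<^sup>2) * suminf (\<lambda>j. real (Suc j) powr (- 1 - s))"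
  have "summable (\<lambda>j. real (Suc j) powr (- 1 - s))"
    using summable_real_powr_iff[of "- 1 - s"] s(1) by (subst summable_Suc_iff) simp
  then have "0 < suminf (\<lambda>j. real (Suc j) powr (- 1 - s))"
    by (rule suminf_pos) simp
  then have "0 < C" unfolding C_def by (intro mult_pos_pos) (simp_all only: of_nat_0_less_iff, simp_all)
  show ?thesis
  proof (intro exI[of _ C] conjI allI impI \<open>0 < C\<close>)
    fix F P a
    assume P: "P \<in> mpolys F d" "P \<noteq> 0" "card (Poly_Mapping.keys P) \<le> k"
      and rho: "rho d a > enat (total_degree P)"
    let ?D = "total_degree P"
    let ?\<Delta> = "\<bar>mahler 1 (subst_powers a P) - mahler d (laurent_of P)\<bar>"
    have bound: "?\<Delta> \<le> C * real (Suc n) powr (- s)" if "enat (n * ?D) < rho d a" for n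
      unfolding C_def s_def
      by (rule abs_mahler_diff_le[OF P(1,2) _ \<open>1 \<le> K\<close> no_relation_if_less_rho[OF rho] no_relation_if_less_rho[OF that]])
        (use P(3) k in simp)
    \<comment> \<open>If every truncation is allowed, the error tends to 0. This covers both
      infinite \<open>rho\<close> and constant \<open>P\<close>.\<close>
    have zero: "?\<Delta> = 0" if "\<And>n. enat (n * ?D) < rho d a"
    proof -
      have "(\<lambda>n. C * real (Suc n) powr (- s)) \<longlonglongrightarrow> C * 0"
        using s(1) by (intro tendsto_intros tendsto_neg_powr filterlim_compose[OF filterlim_real_sequentially filterlim_Suc]) auto
      then have "?\<Delta> \<le> C * 0"
        by (rule tendsto_lowerbound) (use bound that in auto)
      then show ?thesis by simp
    qed
    show "case rho d a of
         enat r \<Rightarrow> ?\<Delta> \<le> C * (real ?D ^ (16 * d\<^sup>2) / real r powr (1 / (16 * (real k - 1))))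
       | \<infinity> \<Rightarrow> mahler 1 (subst_powers a P) = mahler d (laurent_of P)"
    proof (cases "rho d a")
      case infinity
      then show ?thesis using zero by simp
    next
      case (enat r)
      with rho have r: "?D < r" by simp
      show ?thesis
      proof (cases "?D = 0")
        case True
        \<comment> \<open>For constant \<open>P\<close> the claimed bound is 0, a positive power of
          0, so exact equality has to be shown.\<close>
        have "enat (n * ?D) < rho d a" for n
          unfolding enat enat_ord_simps using True r by simp
        then have "?\<Delta> = 0" by (rule zero)
        moreover have "0 \<le> C * (real ?D ^ (16 * d\<^sup>2) / real r powr (1 / (16 * (real k - 1))))"
          using \<open>0 < C\<close> by simp
        ultimately show ?thesis using enat by simp
      next
        case False
        \<comment> \<open>The largest n with n deg P < r; consequently n + 1 is at least r / deg
          P.\<close>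
        define n where "n = (r - 1) div ?D"
        have "n * ?D \<le> r - 1" unfolding n_def by (rule div_times_less_eq_dividend)
        with r have "n * ?D < r" by linarith
        then have "?\<Delta> \<le> C * real (Suc n) powr (- s)" using bound enat by simp
        also have "real (Suc n) powr (- s) \<le> (r / ?D) powr (- s)"
        proof (rule powr_mono2')
          have "r - 1 < Suc n * ?D"
            unfolding n_def using False dividend_less_div_times[of ?D "r - 1"] by simp
          then have "r \<le> Suc n * ?D" by linarith
          then show "real r / real ?D \<le> real (Suc n)"
            using False by (simp add: divide_le_eq flip: of_nat_mult of_nat_Suc)
        qed (use s r False in auto)
        also have "(r / ?D) powr (- s) = ?D powr s / r powr s"
          using r by (simp add: powr_divide powr_minus field_simps)
        \<comment> \<open>The bound (deg P / r)^s is stronger than the claim: deg P and r are at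
          least 1, s is at most 1, and s is at least the exponent of r in the claim.\<close>
        also have "\<dots> \<le> real ?D ^ (16 * d\<^sup>2) / real r powr (1 / (16 * (real k - 1)))"
        proof (rule frac_le)
          have "?D powr s \<le> real ?D powr 1" using False s by (intro powr_mono) auto
          also have "\<dots> \<le> real ?D ^ (16 * d\<^sup>2)"
            using False \<open>d \<ge> 1\<close> by (simp add: self_le_power)
          finally show "?D powr s \<le> real ?D ^ (16 * d\<^sup>2)" .
          show "real r powr (1 / (16 * (real k - 1))) \<le> r powr s"
            using s r by (intro powr_mono) auto
        qed (use r in auto)
        finally show ?thesis using enat \<open>0 < C\<close> by (simp add: mult_left_mono)
      qed
    qed
  qed
qed

end
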